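(* Let $S^*=\inf\{S:\mathbb{P}(D[0,\tau]\le S)\ge \frac{p}{p+h}\}$ be the optimal base-stock level of the back-order system $\mathcal{B}$ and let $$C^{\mathcal{B}*}=h\,\mathbb{E}\big[(S^*-D[0,\tau])^+\big]+p\,\mathbb{E}\big[(D[0,\tau]-S^* )^+\big]$$ be its optimal cost-rate (the cost-rate of $\mathcal{B}$ under the optimal base-stock policy with level $S^*$, or equivalently under the PIL policy with parameter $S^*-\tau\mu$). Let $U^*\in\operatorname{argmin}_{U\ge 0}C(\mathrm{P}^U)$. Then the lost sales system $\mathcal{L}$ controlled by the PIL policy with level $(S^*-\tau\mu)^+$ has cost-rate at most the optimal cost-rate of $\mathcal{B}$, that is, $$C(\mathrm{P}^{U^*})\le C(\mathrm{P}^{(S^*-\tau\mu)^+})\le C^{\mathcal{B}*}.$$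
   Context: Lost sales system $\mathcal{L}$. Periods are $t\in\mathbb{N}_0=\{0,1,2,\dots\}$; $\tau\in\mathbb{N}_0$ is the lead time, $h>0$ the holding cost and $p>0$ the lost sales penalty cost. Demands $D_0,D_1,\dots$ are i.i.d. nonnegative random variables with $\mu=\mathbb{E}[D_t]<\infty$, and $D[a,b]=\sum_{i=a}^b D_i$. $q_t\ge 0$ is the order arriving at the start of period $t$; the order $q_{t+\tau}$ is placed in period $t$, before $D_t$ is observed. $I_t$ is the inventory at the start of period $t$ after receiving $q_t$. With $(x)^+=\max(0,x)$, the dynamics are $L_t=(D_t-I_t)^+$ (lost sales), $J_t=(I_t-D_t)^+$ (end-of-period inventory), $I_t=J_{t-1}+q_t$. The state in period $t$ is $\mathbf{x}_t=(I_t,q_{t+1},\dots,q_{t+\tau-1})\in\mathbb{R}_+^\tau$ (for $\tau=0$ it is the inventory $J_{t-1}$ before ordering). A policy $\mathrm{A}=\{\mathrm{A}_t\}$ sets $q_{t+\tau}=\mathrm{A}_t(\mathbf{x}_t)\ge 0$. The initial state is $\mathbf{x}_0=\mathbf{0}$, i.e. $I_0=0$ and $q_t=0$ for $t<\tau$ (for $\tau=0$: $J_{-1}=0$). The projected inventory level (PIL) policy $\mathrm{P}^U$, $U\ge0$, is $\mathrm{P}^U_t(\mathbf{x}_t)=(U-\mathbb{E}[J_{t+\tau-1}\mid\mathbf{x}_t])^+$. The cost-rate is $C(\mathrm{A})=\limsup_{T\to\infty}\mathbb{E}\big[\frac{1}{T-\tau+1}\sum_{t=\tau}^T(hJ_t+pL_t)\big]$,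 with costs incurred under $\mathrm{A}$. Back-order system $\mathcal{B}$: same demands, lead time and $h$, with back-order cost $p$ per item per period. Dynamics $I^{\mathcal{B}}_t=I^{\mathcal{B}}_{t-1}-D_{t-1}+q^{\mathcal{B}}_t$, $J^{\mathcal{B}}_t=(I^{\mathcal{B}}_t-D_t)^+$, $B_t=(D_t-I^{\mathcal{B}}_t)^+$, with period cost $hJ^{\mathcal{B}}_t+pB_t$. The base-stock policy with level $S$ orders $q^{\mathcal{B}}_{t+\tau}=S-I^{\mathcal{B}}_t-\sum_{i=t+1}^{t+\tau-1}q^{\mathcal{B}}_i$; since this makes the expected inventory level at the arrival of the order equal to $S-\tau\mu$, it is also the PIL policy with parameter $S-\tau\mu$ in $\mathcal{B}$. *)

theory Defs
  imports "HOL-Probability.Probability"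
begin

section \<open>The lost sales system\<close>

text \<open>
  The dynamics are defined for one path \<open>d\<close> of the demand process and a policy \<open>A\<close>, where
  \<open>A t x\<close> is the order placed in period \<open>t\<close> in state \<open>x\<close>:
  \<open>ls_order\<close> is $q_t$, \<open>ls_inv\<close> is $I_t$, \<open>ls_carry\<close> is $J_{t-1}$ (with $J_{-1} = 0$), and
  \<open>ls_state\<close> is $(I_t, q_{t+1}, \ldots, q_{t+\tau-1})$, which for $\tau = 0$ is $(J_{t-1})$.
\<close>

function
  ls_order :: "nat \<Rightarrow> (nat \<Rightarrow> real list \<Rightarrow> real) \<Rightarrow> (nat \<Rightarrow> real) \<Rightarrow> nat \<Rightarrow> real" and
  ls_inv :: "nat \<Rightarrow> (nat \<Rightarrow> real list \<Rightarrow> real) \<Rightarrow> (nat \<Rightarrow> real) \<Rightarrow> nat \<Rightarrow> real" and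
  ls_carry :: "nat \<Rightarrow> (nat \<Rightarrow> real list \<Rightarrow> real) \<Rightarrow> (nat \<Rightarrow> real) \<Rightarrow> nat \<Rightarrow> real" and
  ls_state :: "nat \<Rightarrow> (nat \<Rightarrow> real list \<Rightarrow> real) \<Rightarrow> (nat \<Rightarrow> real) \<Rightarrow> nat \<Rightarrow> real list"
where
  "ls_order \<tau> A d t = (if t < \<tau> then 0 else A (t - \<tau>) (ls_state \<tau> A d (t - \<tau>)))"
| "ls_inv \<tau> A d t = ls_carry \<tau> A d t + ls_order \<tau> A d t"
| "ls_carry \<tau> A d t = (if t = 0 then 0 else max 0 (ls_inv \<tau> A d (t - 1) - d (t - 1)))"
| "ls_state \<tau> A d t =
    (if \<tau> = 0 then [ls_carry \<tau> A d t]
     else ls_inv \<tau> A d t # map (ls_order \<tau> A d) [t + 1..<t + \<tau>])"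
  by pat_completeness auto
termination
  by (relation "Wellfounded.measure (\<lambda>x. case x of
        Inl (Inl (\<tau>, A, d, t)) \<Rightarrow> 4 * t + 3
      | Inl (Inr (\<tau>, A, d, t)) \<Rightarrow> 4 * t + 4
      | Inr (Inl (\<tau>, A, d, t)) \<Rightarrow> 4 * t + 1
      | Inr (Inr (\<tau>, A, d, t)) \<Rightarrow> 4 * (t + \<tau>) + 2)") auto

declare ls_order.simps [simp del] ls_inv.simps [simp del]
  ls_carry.simps [simp del] ls_state.simps [simp del]

definition ls_end_inv :: "nat \<Rightarrow> (nat \<Rightarrow> real list \<Rightarrow> real) \<Rightarrow> (nat \<Rightarrow> real) \<Rightarrow> nat \<Rightarrow> real" where
  "ls_end_inv \<tau> A d t = max 0 (ls_inv \<tau> A d t - d t)"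

definition ls_lost :: "nat \<Rightarrow> (nat \<Rightarrow> real list \<Rightarrow> real) \<Rightarrow> (nat \<Rightarrow> real) \<Rightarrow> nat \<Rightarrow> real" where
  "ls_lost \<tau> A d t = max 0 (d t - ls_inv \<tau> A d t)"

text \<open>
  The expectation is a nonnegative integral, so that the cost-rate of every policy is well defined,
  possibly infinite. The terms with $T < \tau$ do not affect the limit superior.
\<close>

definition ls_cost_rate ::
  "'a measure \<Rightarrow> (nat \<Rightarrow> 'a \<Rightarrow> real) \<Rightarrow> nat \<Rightarrow> real \<Rightarrow> real \<Rightarrow> (nat \<Rightarrow> real list \<Rightarrow> real) \<Rightarrow> ennreal" where
  "ls_cost_rate M D \<tau> h p A = limsup (\<lambda>T. \<integral>\<^sup>+ \<omega>.
     ennreal ((1 / (real T - real \<tau> + 1)) *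
       (\<Sum>t = \<tau>..T. h * ls_end_inv \<tau> A (\<lambda>i. D i \<omega>) t + p * ls_lost \<tau> A (\<lambda>i. D i \<omega>) t)) \<partial>M)"


section \<open>Projected inventory level policies\<close>

text \<open>
  \<open>end_inv_from x d k\<close> is $J_{t+k}$ for $k < \tau$, as a function of the state $x$ in period $t$
  and of the demands \<open>d i\<close> $= D_{t+i}$; no order placed from period $t$ on arrives before $t+\tau$.
\<close>

primrec end_inv_from :: "real list \<Rightarrow> (nat \<Rightarrow> real) \<Rightarrow> nat \<Rightarrow> real" where
  "end_inv_from x d 0 = max 0 (x ! 0 - d 0)"
| "end_inv_from x d (Suc k) = max 0 (end_inv_from x d k + x ! Suc k - d (Suc k))"

text \<open>
  \<open>proj_end_inv M D \<tau> t x\<close> is $E[J_{t+\tau-1} \mid \mathbf{x}_t = x]$; since $\mathbf{x}_t$ is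
  determined by $D_0, \ldots, D_{t-1}$, it is the mean over $D_t, \ldots, D_{t+\tau-1}$ for fixed
  \<open>x\<close>. Lemma \<open>real_cond_exp_end_inv\<close> below identifies it with the conditional expectation.
\<close>

definition proj_end_inv ::
  "'a measure \<Rightarrow> (nat \<Rightarrow> 'a \<Rightarrow> real) \<Rightarrow> nat \<Rightarrow> nat \<Rightarrow> real list \<Rightarrow> real" where
  "proj_end_inv M D \<tau> t x =
    (if \<tau> = 0 then x ! 0 else \<integral> \<omega>. end_inv_from x (\<lambda>i. D (t + i) \<omega>) (\<tau> - 1) \<partial>M)"

definition pil_policy ::
  "'a measure \<Rightarrow> (nat \<Rightarrow> 'a \<Rightarrow> real) \<Rightarrow> nat \<Rightarrow> real \<Rightarrow> nat \<Rightarrow> real list \<Rightarrow> real" where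
  "pil_policy M D \<tau> U t x = max 0 (U - proj_end_inv M D \<tau> t x)"


section \<open>The back-order system under base-stock policies\<close>

text \<open>
  \<open>bo_carry\<close> is the net inventory $I^B_{t-1} - D_{t-1}$ before the order of period $t$ arrives,
  with initial value $0$. The sum in \<open>bo_order\<close> starts with the order arriving in the period in
  which the new order is placed, so that for $\tau \ge 1$ the inventory position
  $I^B_t + \sum_{i=t+1}^{t+\tau-1} q^B_i$ is raised to $S$, and for $\tau = 0$ the net inventory.
\<close>

function
  bo_order :: "nat \<Rightarrow> real \<Rightarrow> (nat \<Rightarrow> real) \<Rightarrow> nat \<Rightarrow> real" and
  bo_inv :: "nat \<Rightarrow> real \<Rightarrow> (nat \<Rightarrow> real) \<Rightarrow> nat \<Rightarrow> real" and
  bo_carry :: "nat \<Rightarrow> real \<Rightarrow> (nat \<Rightarrow> real) \<Rightarrow> nat \<Rightarrow> real"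
where
  "bo_order \<tau> S d t =
    (if t < \<tau> then 0
     else S - (bo_carry \<tau> S d (t - \<tau>) + (\<Sum>i = t - \<tau>..<t. bo_order \<tau> S d i)))"
| "bo_inv \<tau> S d t = bo_carry \<tau> S d t + bo_order \<tau> S d t"
| "bo_carry \<tau> S d t = (if t = 0 then 0 else bo_inv \<tau> S d (t - 1) - d (t - 1))"
  by pat_completeness auto
termination
  by (relation "Wellfounded.measure (\<lambda>x. case x of
        Inl (\<tau>, S, d, t) \<Rightarrow> 3 * t + 1
      | Inr (Inl (\<tau>, S, d, t)) \<Rightarrow> 3 * t + 2
      | Inr (Inr (\<tau>, S, d, t)) \<Rightarrow> 3 * t)") auto

declare bo_order.simps [simp del] bo_inv.simps [simp del] bo_carry.simps [simp del]

definition bo_cost_rate ::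
  "'a measure \<Rightarrow> (nat \<Rightarrow> 'a \<Rightarrow> real) \<Rightarrow> nat \<Rightarrow> real \<Rightarrow> real \<Rightarrow> real \<Rightarrow> ennreal" where
  "bo_cost_rate M D \<tau> h p S = limsup (\<lambda>T. \<integral>\<^sup>+ \<omega>.
     ennreal ((1 / (real T - real \<tau> + 1)) *
       (\<Sum>t = \<tau>..T. h * max 0 (bo_inv \<tau> S (\<lambda>i. D i \<omega>) t - D t \<omega>)
                   + p * max 0 (D t \<omega> - bo_inv \<tau> S (\<lambda>i. D i \<omega>) t))) \<partial>M)"

definition base_stock_level ::
  "'a measure \<Rightarrow> (nat \<Rightarrow> 'a \<Rightarrow> real) \<Rightarrow> nat \<Rightarrow> real \<Rightarrow> real \<Rightarrow> real" where
  "base_stock_level M D \<tau> h p =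
     Inf {S. p / (p + h) \<le> measure M {\<omega> \<in> space M. (\<Sum>i = 0..\<tau>. D i \<omega>) \<le> S}}"

definition base_stock_cost ::
  "'a measure \<Rightarrow> (nat \<Rightarrow> 'a \<Rightarrow> real) \<Rightarrow> nat \<Rightarrow> real \<Rightarrow> real \<Rightarrow> real \<Rightarrow> real" where
  "base_stock_cost M D \<tau> h p S =
     h * (\<integral> \<omega>. max 0 (S - (\<Sum>i = 0..\<tau>. D i \<omega>)) \<partial>M)
     + p * (\<integral> \<omega>. max 0 ((\<Sum>i = 0..\<tau>. D i \<omega>) - S) \<partial>M)"


section \<open>The projected inventory level as a conditional expectation\<close>

lemma ls_carry_add_Suc:
  assumes "k < \<tau>"
  shows "ls_carry \<tau> A d (t + Suc k) = end_inv_from (ls_state \<tau> A d t) (\<lambda>i. d (t + i)) k"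
  using assms
proof (induction k)
  case 0
  then show ?case by (simp add: ls_carry.simps[of _ _ _ "Suc t"] ls_state.simps)
next
  case (Suc k)
  have "ls_state \<tau> A d t ! Suc k = ls_order \<tau> A d (t + Suc k)"
    using Suc.prems by (simp add: ls_state.simps)
  then show ?case
    using Suc by (simp add: ls_carry.simps[of _ _ _ "Suc (Suc (t + k))"] ls_inv.simps)
qed

lemma ls_cong_aux:
  assumes "\<And>i. i < n \<Longrightarrow> d i = d' i"
  shows "(s - \<tau> \<le> n \<longrightarrow> ls_order \<tau> A d s = ls_order \<tau> A d' s) \<and>
    (s \<le> n \<longrightarrow> ls_inv \<tau> A d s = ls_inv \<tau> A d' s \<and> ls_carry \<tau> A d s = ls_carry \<tau> A d' s)"
proof (induction s rule: less_induct)
  case (less s)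
  have c: "ls_carry \<tau> A d s = ls_carry \<tau> A d' s" if "s \<le> n"
    using less[of "s - 1"] that assms[of "s - 1"] by (simp add: ls_carry.simps[of _ _ _ s])
  have o: "ls_order \<tau> A d s = ls_order \<tau> A d' s" if "s - \<tau> \<le> n"
  proof (cases "s < \<tau>")
    case False
    have "ls_state \<tau> A d (s - \<tau>) = ls_state \<tau> A d' (s - \<tau>)"
      using that False c less by (cases "\<tau> = 0") (auto simp: ls_state.simps)
    then show ?thesis by (simp add: ls_order.simps[of _ _ _ s])
  qed (simp add: ls_order.simps)
  show ?case using c o by (simp add: ls_inv.simps[of _ _ _ s])
qed

lemma ls_state_cong:
  assumes "\<And>i. i < t \<Longrightarrow> d i = d' i"
  shows "ls_state \<tau> A d t = ls_state \<tau> A d' t"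
  using ls_cong_aux[of t d d', OF assms] by (auto simp: ls_state.simps)

lemma ls_measurable_aux:
  assumes A: "\<And>t x. (\<And>k. k < max 1 \<tau> \<Longrightarrow> (\<lambda>\<omega>. x \<omega> ! k) \<in> borel_measurable N)
      \<Longrightarrow> (\<lambda>\<omega>. A t (x \<omega>)) \<in> borel_measurable N"
    and d: "\<And>i. i < n \<Longrightarrow> (\<lambda>\<omega>. d \<omega> i) \<in> borel_measurable N"
  shows "(s - \<tau> \<le> n \<longrightarrow> (\<lambda>\<omega>. ls_order \<tau> A (d \<omega>) s) \<in> borel_measurable N) \<and>
    (s \<le> n \<longrightarrow> (\<lambda>\<omega>. ls_inv \<tau> A (d \<omega>) s) \<in> borel_measurable N \<and>
       (\<lambda>\<omega>. ls_carry \<tau> A (d \<omega>) s) \<in> borel_measurable N)"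
proof (induction s rule: less_induct)
  case (less s)
  have c: "(\<lambda>\<omega>. ls_carry \<tau> A (d \<omega>) s) \<in> borel_measurable N" if "s \<le> n"
  proof (cases "s = 0")
    case False
    then have "s - 1 < s" "s - 1 < n" using that by auto
    then have "(\<lambda>\<omega>. max 0 (ls_inv \<tau> A (d \<omega>) (s - 1) - d \<omega> (s - 1))) \<in> borel_measurable N"
      using less[of "s - 1"] d[of "s - 1"]
      by (intro borel_measurable_max borel_measurable_diff) auto
    then show ?thesis using False by (simp add: ls_carry.simps[of _ _ _ s])
  qed (simp add: ls_carry.simps)
  have o: "(\<lambda>\<omega>. ls_order \<tau> A (d \<omega>) s) \<in> borel_measurable N" if "s - \<tau> \<le> n"
  proof (cases "s < \<tau>")
    case False
    have "(\<lambda>\<omega>. ls_state \<tau> A (d \<omega>) (s - \<tau>) ! k) \<in> borel_measurable N" if "k < max 1 \<tau>" for k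
    proof (cases "\<tau> = 0")
      case True
      then show ?thesis using that \<open>s - \<tau> \<le> n\<close> c by (simp add: ls_state.simps)
    next
      case nz: False
      show ?thesis
      proof (cases k)
        case 0
        then show ?thesis using less[of "s - \<tau>"] nz \<open>s - \<tau> \<le> n\<close> False
          by (simp add: ls_state.simps)
      next
        case (Suc j)
        then show ?thesis using less[of "s - \<tau> + k"] nz \<open>s - \<tau> \<le> n\<close> False that
          by (simp add: ls_state.simps)
      qed
    qed
    then have "(\<lambda>\<omega>. A (s - \<tau>) (ls_state \<tau> A (d \<omega>) (s - \<tau>))) \<in> borel_measurable N"
      by (rule A)
    then show ?thesis using False by (simp add: ls_order.simps[of _ _ _ s])
  qed (simp add: ls_order.simps)
  show ?case using c o by (simp add: ls_inv.simps[of _ _ _ s])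
qed

lemma ls_state_measurable:
  assumes A: "\<And>t x. (\<And>k. k < max 1 \<tau> \<Longrightarrow> (\<lambda>\<omega>. x \<omega> ! k) \<in> borel_measurable N)
      \<Longrightarrow> (\<lambda>\<omega>. A t (x \<omega>)) \<in> borel_measurable N"
    and d: "\<And>i. i < t \<Longrightarrow> (\<lambda>\<omega>. d \<omega> i) \<in> borel_measurable N"
    and k: "k < max 1 \<tau>"
  shows "(\<lambda>\<omega>. ls_state \<tau> A (d \<omega>) t ! k) \<in> borel_measurable N"
proof -
  note * = ls_measurable_aux[where N = N and \<tau> = \<tau> and A = A and n = t and d = d, OF A d]
  show ?thesis
  proof (cases "\<tau> = 0")
    case True
    then show ?thesis using k *[of t] by (simp add: ls_state.simps)
  next
    case False
    then show ?thesis
      using k *[of t] *[of "t + k"] by (cases k) (auto simp: ls_state.simps)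
  qed
qed

lemma end_inv_from_measurable:
  assumes "\<And>i. i \<le> k \<Longrightarrow> (\<lambda>\<omega>. x \<omega> ! i) \<in> borel_measurable N"
    and "\<And>i. i \<le> k \<Longrightarrow> (\<lambda>\<omega>. d \<omega> i) \<in> borel_measurable N"
  shows "(\<lambda>\<omega>. end_inv_from (x \<omega>) (d \<omega>) k) \<in> borel_measurable N"
  using assms by (induction k) auto

lemma end_inv_from_nonneg: "0 \<le> end_inv_from x d k"
  by (cases k) auto

lemma (in prob_space) proj_end_inv_measurable:
  assumes D: "\<And>i. random_variable borel (D i)"
    and x: "\<And>k. k < max 1 \<tau> \<Longrightarrow> (\<lambda>\<omega>. x \<omega> ! k) \<in> borel_measurable N"
  shows "(\<lambda>\<omega>. proj_end_inv M D \<tau> t (x \<omega>)) \<in> borel_measurable N"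
proof (cases "\<tau> = 0")
  case True
  then show ?thesis using x[of 0] by (simp add: proj_end_inv_def)
next
  case False
  have "(\<lambda>z. end_inv_from (x (fst z)) (\<lambda>i. D (t + i) (snd z)) (\<tau> - 1))
      \<in> borel_measurable (N \<Otimes>\<^sub>M M)"
  proof (rule end_inv_from_measurable)
    fix i assume "i \<le> \<tau> - 1"
    then show "(\<lambda>z. x (fst z) ! i) \<in> borel_measurable (N \<Otimes>\<^sub>M M)"
      using False by (intro measurable_compose[OF measurable_fst x]) auto
    show "(\<lambda>z. D (t + i) (snd z)) \<in> borel_measurable (N \<Otimes>\<^sub>M M)"
      by (intro measurable_compose[OF measurable_snd D])
  qed
  then have "(\<lambda>\<omega>. \<integral> \<omega>'. end_inv_from (x \<omega>) (\<lambda>i. D (t + i) \<omega>') (\<tau> - 1) \<partial>M) \<in> borel_measurable N"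
    by (intro borel_measurable_lebesgue_integral) (simp add: split_def)
  then show ?thesis using False by (simp add: proj_end_inv_def)
qed

lemma ls_carry_nonneg: "0 \<le> ls_carry \<tau> A d t"
  by (simp add: ls_carry.simps)

lemma ls_order_pil:
  assumes "0 \<le> U"
  shows "0 \<le> ls_order \<tau> (pil_policy M D \<tau> U) d t \<and> ls_order \<tau> (pil_policy M D \<tau> U) d t \<le> U"
proof (cases "t < \<tau>")
  case True
  then show ?thesis using assms by (simp add: ls_order.simps)
next
  case False
  let ?x = "ls_state \<tau> (pil_policy M D \<tau> U) d (t - \<tau>)"
  have "0 \<le> proj_end_inv M D \<tau> (t - \<tau>) ?x"
    unfolding proj_end_inv_def
    by (auto simp: ls_state.simps[of 0] ls_carry_nonneg end_inv_from_nonneg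
        intro!: Bochner_Integration.integral_nonneg)
  then show ?thesis using assms False by (simp add: ls_order.simps[of _ _ _ t] pil_policy_def)
qed

lemma ls_carry_pil_le:
  assumes "0 \<le> U" and "\<And>i. 0 \<le> d i"
  shows "ls_carry \<tau> (pil_policy M D \<tau> U) d t \<le> real t * U"
proof (induction t)
  case 0
  then show ?case by (simp add: ls_carry.simps)
next
  case (Suc t)
  then show ?case
    using ls_order_pil[OF assms(1), of \<tau> M D d t] assms(2)[of t] assms(1)
    by (simp add: ls_carry.simps[of _ _ _ "Suc t"] ls_inv.simps algebra_simps)
qed

lemma (in prob_space) real_cond_exp_end_inv:
  fixes D :: "nat \<Rightarrow> 'a \<Rightarrow> real" and \<tau> t :: nat and U :: real
  assumes indep: "indep_vars (\<lambda>_. borel) D UNIV"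
    and nonneg: "\<And>t \<omega>. \<omega> \<in> space M \<Longrightarrow> 0 \<le> D t \<omega>"
    and U: "0 \<le> U"
  defines "A \<equiv> pil_policy M D \<tau> U"
  defines "F \<equiv> vimage_algebra (space M)
      (\<lambda>\<omega>. \<lambda>k\<in>{..<max 1 \<tau>}. ls_state \<tau> A (\<lambda>i. D i \<omega>) t ! k) (PiM {..<max 1 \<tau>} (\<lambda>_. borel))"
  shows "AE \<omega> in M. real_cond_exp M F (\<lambda>\<omega>. ls_carry \<tau> A (\<lambda>i. D i \<omega>) (t + \<tau>)) \<omega> =
      proj_end_inv M D \<tau> t (ls_state \<tau> A (\<lambda>i. D i \<omega>) t)"
proof -
  have D[measurable]: "random_variable borel (D i)" for i
    using indep by (auto simp: indep_vars_def)
  define f where "f \<omega> = ls_carry \<tau> A (\<lambda>i. D i \<omega>) (t + \<tau>)" for \<omega>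
  define g where "g \<omega> = proj_end_inv M D \<tau> t (ls_state \<tau> A (\<lambda>i. D i \<omega>) t)" for \<omega>
  let ?P = "PiM {..<max 1 \<tau>} (\<lambda>_. borel :: real measure)"
  let ?X = "\<lambda>\<omega>. \<lambda>k\<in>{..<max 1 \<tau>}. ls_state \<tau> A (\<lambda>i. D i \<omega>) t ! k"
  have Am: "(\<lambda>\<omega>. A t (x \<omega>)) \<in> borel_measurable N"
    if "\<And>k. k < max 1 \<tau> \<Longrightarrow> (\<lambda>\<omega>. x \<omega> ! k) \<in> borel_measurable N" for t x and N :: "'c measure"
    unfolding A_def pil_policy_def
    by (intro borel_measurable_max borel_measurable_diff borel_measurable_const
        proj_end_inv_measurable[OF D that])
  have xm: "(\<lambda>\<omega>. ls_state \<tau> A (\<lambda>i. D i \<omega>) t ! k) \<in> borel_measurable M" if "k < max 1 \<tau>" for k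
    using that by (intro ls_state_measurable[where N = M] Am D) auto
  have Xm: "?X \<in> measurable M ?P"
    using xm by (intro measurable_restrict) auto
  have sub: "subalgebra M F"
    using sets_image_in_sets[OF refl Xm] unfolding subalgebra_def F_def by simp
  interpret sigma_finite_subalgebra M F
    by (intro finite_measure_subalgebra_is_sigma_finite finite_measure_subalgebra.intro
        finite_measure_subalgebra_axioms.intro sub finite_measure_axioms)
  have fm: "f \<in> borel_measurable M"
    unfolding f_def
    using ls_measurable_aux[where N = M and n = "t + \<tau>" and s = "t + \<tau>" and d = "\<lambda>\<omega> i. D i \<omega>", OF Am D]
    by auto
  have fi: "integrable M f"
  proof (rule integrable_const_bound[OF _ fm])
    show "AE \<omega> in M. norm (f \<omega>) \<le> real (t + \<tau>) * U"
    proof (rule AE_I2)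
      fix \<omega> assume "\<omega> \<in> space M"
      then show "norm (f \<omega>) \<le> real (t + \<tau>) * U"
        unfolding f_def A_def
        using ls_carry_pil_le[OF U, of "\<lambda>i. D i \<omega>" \<tau> M D "t + \<tau>"] nonneg
        by (simp add: ls_carry_nonneg)
    qed
  qed
  have xF: "(\<lambda>\<omega>. ls_state \<tau> A (\<lambda>i. D i \<omega>) t ! k) \<in> borel_measurable F" if k: "k < max 1 \<tau>" for k
  proof -
    have "?X \<in> measurable F ?P"
      unfolding F_def by (rule measurable_vimage_algebra1) (use Xm in \<open>auto simp: measurable_def\<close>)
    from measurable_compose[OF this measurable_component_singleton[of k]] k
    show ?thesis by simp
  qed
  have gF: "g \<in> borel_measurable F"
    unfolding g_def by (intro proj_end_inv_measurable D xF)
  have "AE \<omega> in M. real_cond_exp M F f \<omega> = g \<omega>"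
  proof (cases "\<tau> = 0")
    case True
    have "f = g" by (auto simp: f_def g_def proj_end_inv_def ls_state.simps True)
    then show ?thesis using fi gF by (metis real_cond_exp_F_meas)
  next
    case nz: False
    let ?I = "{..<t}" and ?J = "{t..<t+\<tau>}"
    let ?N1 = "PiM ?I (\<lambda>_. borel :: real measure)" and ?N2 = "PiM ?J (\<lambda>_. borel :: real measure)"
    define V where "V \<omega> = (\<lambda>i\<in>?I. D i \<omega>)" for \<omega>
    define W where "W \<omega> = (\<lambda>i\<in>?J. D i \<omega>)" for \<omega>
    define \<phi> where "\<phi> v w = end_inv_from (ls_state \<tau> A v t) (\<lambda>i. w (t + i)) (\<tau> - 1)"
      for v w :: "nat \<Rightarrow> real"
    have ind: "indep_var ?N1 V ?N2 W"
      unfolding V_def W_def by (rule indep_var_restrict[OF indep]) auto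
    then have Vm[measurable]: "V \<in> measurable M ?N1" and Wm[measurable]: "W \<in> measurable M ?N2"
      and VW: "distr M ?N1 V \<Otimes>\<^sub>M distr M ?N2 W = distr M (?N1 \<Otimes>\<^sub>M ?N2) (\<lambda>\<omega>. (V \<omega>, W \<omega>))"
      by (auto simp: indep_var_distribution_eq)
    interpret PV: prob_space "distr M ?N1 V" by (rule prob_space_distr) simp
    interpret PW: prob_space "distr M ?N2 W" by (rule prob_space_distr) simp
    interpret VW: pair_prob_space "distr M ?N1 V" "distr M ?N2 W" ..
    have stV: "ls_state \<tau> A (V \<omega>) t = ls_state \<tau> A (\<lambda>i. D i \<omega>) t" for \<omega>
      by (rule ls_state_cong) (simp add: V_def)
    have eW: "end_inv_from x (\<lambda>i. W \<omega> (t + i)) k = end_inv_from x (\<lambda>i. D (t + i) \<omega>) k"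
      if "k < \<tau>" for x k \<omega> using that by (induction k) (auto simp: W_def)
    have f\<phi>: "f \<omega> = \<phi> (V \<omega>) (W \<omega>)" for \<omega>
      using ls_carry_add_Suc[of "\<tau> - 1" \<tau> A "\<lambda>i. D i \<omega>" t] nz
      by (simp add: f_def \<phi>_def stV eW)
    have g\<phi>: "g \<omega> = (\<integral> \<omega>'. \<phi> (V \<omega>) (W \<omega>') \<partial>M)" for \<omega>
      using nz by (simp add: g_def \<phi>_def stV eW proj_end_inv_def)
    have xv: "(\<lambda>v. ls_state \<tau> A v t ! k) \<in> borel_measurable ?N1" if "k < max 1 \<tau>" for k
      using that by (intro ls_state_measurable[where N = ?N1 and d = "\<lambda>v. v"] Am) auto
    have \<phi>m: "(\<lambda>z. \<phi> (fst z) (snd z)) \<in> borel_measurable (?N1 \<Otimes>\<^sub>M ?N2)"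
      unfolding \<phi>_def
    proof (rule end_inv_from_measurable)
      fix i assume i: "i \<le> \<tau> - 1"
      then show "(\<lambda>z. ls_state \<tau> A (fst z) t ! i) \<in> borel_measurable (?N1 \<Otimes>\<^sub>M ?N2)"
        using nz by (intro measurable_compose[OF measurable_fst xv]) auto
      show "(\<lambda>z. snd z (t + i)) \<in> borel_measurable (?N1 \<Otimes>\<^sub>M ?N2)"
        using i nz by (intro measurable_compose[OF measurable_snd measurable_component_singleton]) auto
    qed
    have key: "integrable M (\<lambda>\<omega>. c (V \<omega>) * g \<omega>) \<and>
        (\<integral> \<omega>. c (V \<omega>) * f \<omega> \<partial>M) = (\<integral> \<omega>. c (V \<omega>) * g \<omega> \<partial>M)"
      if c[measurable]: "c \<in> borel_measurable ?N1" and cf: "integrable M (\<lambda>\<omega>. c (V \<omega>) * f \<omega>)" for c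
    proof -
      define \<psi> where "\<psi> v w = c v * \<phi> v w" for v w
      have \<psi>m: "(\<lambda>z. \<psi> (fst z) (snd z)) \<in> borel_measurable (?N1 \<Otimes>\<^sub>M ?N2)"
        unfolding \<psi>_def using \<phi>m by measurable
      have i1: "integrable (distr M (?N1 \<Otimes>\<^sub>M ?N2) (\<lambda>\<omega>. (V \<omega>, W \<omega>))) (\<lambda>z. \<psi> (fst z) (snd z))"
        using cf by (subst integrable_distr_eq) (use \<psi>m in \<open>auto simp: \<psi>_def f\<phi>\<close>)
      then have i2: "integrable (distr M ?N1 V \<Otimes>\<^sub>M distr M ?N2 W) (\<lambda>(v, w). \<psi> v w)"
        by (simp add: VW split_def)
      have inner: "(\<integral> w. \<psi> (V \<omega>) w \<partial>distr M ?N2 W) = c (V \<omega>) * g \<omega>" if "\<omega> \<in> space M" for \<omega>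
      proof -
        have "(\<lambda>w. \<phi> (V \<omega>) w) \<in> borel_measurable ?N2"
          using measurable_compose[OF measurable_Pair1'[OF measurable_space[OF Vm that]] \<phi>m] by simp
        then show ?thesis by (simp add: \<psi>_def g\<phi> integral_distr)
      qed
      have i3: "integrable (distr M ?N1 V) (\<lambda>v. \<integral> w. \<psi> v w \<partial>distr M ?N2 W)"
        using VW.integrable_fst[OF i2] .
      then have "integrable M (\<lambda>\<omega>. \<integral> w. \<psi> (V \<omega>) w \<partial>distr M ?N2 W)"
        by (rule integrable_distr[OF Vm])
      then have I: "integrable M (\<lambda>\<omega>. c (V \<omega>) * g \<omega>)"
        by (rule Bochner_Integration.integrable_cong[THEN iffD1, rotated 2]) (auto simp: inner)
      have "(\<integral> \<omega>. c (V \<omega>) * f \<omega> \<partial>M) =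
          integral\<^sup>L (distr M (?N1 \<Otimes>\<^sub>M ?N2) (\<lambda>\<omega>. (V \<omega>, W \<omega>))) (\<lambda>z. \<psi> (fst z) (snd z))"
        by (subst integral_distr) (use \<psi>m in \<open>auto simp: \<psi>_def f\<phi>\<close>)
      also have "\<dots> = integral\<^sup>L (distr M ?N1 V \<Otimes>\<^sub>M distr M ?N2 W) (\<lambda>(v, w). \<psi> v w)"
        by (simp add: VW split_def)
      also have "\<dots> = (\<integral> v. \<integral> w. \<psi> v w \<partial>distr M ?N2 W \<partial>distr M ?N1 V)"
        using VW.integral_fst[OF i2] by simp
      also have "\<dots> = (\<integral> \<omega>. \<integral> w. \<psi> (V \<omega>) w \<partial>distr M ?N2 W \<partial>M)"
        by (rule integral_distr[OF Vm]) (use borel_measurable_integrable[OF i3] in simp)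
      also have "\<dots> = (\<integral> \<omega>. c (V \<omega>) * g \<omega> \<partial>M)"
        by (rule Bochner_Integration.integral_cong) (auto simp: inner)
      finally show ?thesis using I by simp
    qed
    have gi: "integrable M g"
      using key[of "\<lambda>_. 1"] fi by simp
    show ?thesis
    proof (rule real_cond_exp_charact[OF _ fi gi gF])
      fix B assume "B \<in> sets F"
      moreover have "?X \<in> space M \<rightarrow> space ?P" using Xm by (auto simp: measurable_def)
      ultimately obtain C where C: "C \<in> sets ?P" and B: "B = ?X -` C \<inter> space M"
        unfolding F_def by (subst (asm) sets_vimage_algebra2) auto
      define Y where "Y v = (\<lambda>k\<in>{..<max 1 \<tau>}. ls_state \<tau> A v t ! k)" for v
      define c :: "(nat \<Rightarrow> real) \<Rightarrow> real" where "c v = indicator C (Y v)" for v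
      have Ym: "Y \<in> measurable ?N1 ?P"
        unfolding Y_def using xv by (intro measurable_restrict) auto
      have cm: "c \<in> borel_measurable ?N1"
        unfolding c_def by (rule measurable_compose[OF Ym]) (use C in simp)
      have cV: "c (V \<omega>) = indicator B \<omega>" if "\<omega> \<in> space M" for \<omega>
        using that by (simp add: c_def Y_def stV B indicator_def)
      have BM: "B \<in> sets M" using Xm C B by (auto dest: measurable_sets)
      have "integrable M (\<lambda>\<omega>. indicator B \<omega> * f \<omega>)"
        using integrable_mult_indicator[OF BM fi] by simp
      then have cf: "integrable M (\<lambda>\<omega>. c (V \<omega>) * f \<omega>)"
        by (rule Bochner_Integration.integrable_cong[THEN iffD1, rotated 2]) (auto simp: cV)
      have "(\<integral> \<omega>\<in>B. f \<omega> \<partial>M) = (\<integral> \<omega>. c (V \<omega>) * f \<omega> \<partial>M)"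
        unfolding set_lebesgue_integral_def
        by (rule Bochner_Integration.integral_cong) (auto simp: cV)
      also have "\<dots> = (\<integral> \<omega>. c (V \<omega>) * g \<omega> \<partial>M)" using key[OF cm cf] by simp
      also have "\<dots> = (\<integral> \<omega>\<in>B. g \<omega> \<partial>M)"
        unfolding set_lebesgue_integral_def
        by (rule Bochner_Integration.integral_cong) (auto simp: cV)
      finally show "(\<integral> \<omega>\<in>B. f \<omega> \<partial>M) = (\<integral> \<omega>\<in>B. g \<omega> \<partial>M)" .
    qed
  qed
  then show ?thesis by (simp add: f_def[abs_def] g_def)
qed


section \<open>The cost-rate of the back-order system and the optimal base-stock level\<close>

lemma bo_carry_add:
  "bo_carry \<tau> S d (t + k) = bo_carry \<tau> S d t + (\<Sum>i = t..<t + k. bo_order \<tau> S d i - d i)"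
proof (induction k)
  case (Suc k)
  then show ?case by (simp add: bo_carry.simps[of _ _ _ "Suc (t + k)"] bo_inv.simps)
qed simp

lemma bo_inv_eq: "bo_inv \<tau> S d (t + \<tau>) = S - (\<Sum>i = t..<t + \<tau>. d i)"
  by (simp add: bo_inv.simps bo_carry_add bo_order.simps[of _ _ _ "t + \<tau>"] sum_subtractf)

lemma (in prob_space) distr_sum_shift:
  fixes D :: "nat \<Rightarrow> 'a \<Rightarrow> real"
  assumes indep: "indep_vars (\<lambda>_. borel) D UNIV"
    and ident: "\<And>t. distr M borel (D t) = distr M borel (D 0)"
  shows "distr M borel (\<lambda>\<omega>. \<Sum>i = 0..n. D (s + i) \<omega>) = distr M borel (\<lambda>\<omega>. \<Sum>i = 0..n. D i \<omega>)"
proof -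
  have D[measurable]: "random_variable borel (D i)" for i
    using indep by (auto simp: indep_vars_def)
  let ?P = "PiM {0..n} (\<lambda>_. borel :: real measure)"
  have *: "distr M ?P (\<lambda>\<omega>. \<lambda>i\<in>{0..n}. D (s + i) \<omega>) = PiM {0..n} (\<lambda>_. distr M borel (D 0))" for s
  proof -
    have "indep_vars (\<lambda>j. PiM {s + j} (\<lambda>_. borel)) (\<lambda>j \<omega>. restrict (\<lambda>i. D i \<omega>) {s + j}) {0..n}"
      by (rule indep_vars_restrict[OF indep]) (auto simp: disjoint_family_on_def)
    then have "indep_vars (\<lambda>_. borel) (\<lambda>j. (\<lambda>f. f (s + j)) \<circ> (\<lambda>\<omega>. restrict (\<lambda>i. D i \<omega>) {s + j})) {0..n}"
      by (rule indep_vars_compose) auto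
    then have "indep_vars (\<lambda>_. borel) (\<lambda>j. D (s + j)) {0..n}"
      by (simp add: comp_def)
    then have "distr M ?P (\<lambda>\<omega>. \<lambda>i\<in>{0..n}. D (s + i) \<omega>) =
        PiM {0..n} (\<lambda>i. distr M borel (D (s + i)))"
      by (subst (asm) indep_vars_iff_distr_eq_PiM') auto
    also have "\<dots> = PiM {0..n} (\<lambda>_. distr M borel (D 0))"
      by (rule PiM_cong[OF refl ident])
    finally show ?thesis .
  qed
  have "distr M borel (\<lambda>\<omega>. \<Sum>i = 0..n. D (s + i) \<omega>) =
      distr (distr M ?P (\<lambda>\<omega>. \<lambda>i\<in>{0..n}. D (s + i) \<omega>)) borel (\<lambda>f. \<Sum>i = 0..n. f i)" for s
    by (subst distr_distr) (auto simp: comp_def intro!: measurable_restrict)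
  from this[of s] this[of 0] show ?thesis unfolding * by simp
qed

lemma (in prob_space) bo_cost_rate_eq:
  fixes D :: "nat \<Rightarrow> 'a \<Rightarrow> real" and h p S :: real and \<tau> :: nat
  assumes indep: "indep_vars (\<lambda>_. borel) D UNIV"
    and ident: "\<And>t. distr M borel (D t) = distr M borel (D 0)"
    and int: "integrable M (D 0)"
    and "0 < h" "0 < p"
  shows "bo_cost_rate M D \<tau> h p S = ennreal (base_stock_cost M D \<tau> h p S)"
proof -
  have D[measurable]: "random_variable borel (D i)" for i
    using indep by (auto simp: indep_vars_def)
  have Di[simp]: "integrable M (D i)" for i
  proof -
    have "integrable (distr M borel (D i)) (\<lambda>x. x)"
      unfolding ident[of i] by (subst integrable_distr_eq) (auto simp: int)
    then show ?thesis by (subst (asm) integrable_distr_eq) auto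
  qed
  define X where "X s \<omega> = (\<Sum>i = 0..\<tau>. D (s + i) \<omega>)" for s \<omega>
  define f where "f x = h * max 0 (S - x) + p * max 0 (x - S)" for x :: real
  have Xm[measurable]: "random_variable borel (X s)" for s unfolding X_def by measurable
  have fm[measurable]: "f \<in> borel_measurable borel" unfolding f_def by measurable
  have Xi: "integrable M (X s)" for s unfolding X_def by simp
  have fi: "integrable M (\<lambda>\<omega>. f (X s \<omega>))" for s
    unfolding f_def by (intro Bochner_Integration.integrable_add integrable_mult_right
        integrable_max Bochner_Integration.integrable_diff Xi) auto
  have f0: "(\<integral> \<omega>. f (X 0 \<omega>) \<partial>M) = base_stock_cost M D \<tau> h p S"
    unfolding f_def base_stock_cost_def X_def[symmetric]
    by (subst Bochner_Integration.integral_add)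
      (auto intro!: integrable_mult_right integrable_max Bochner_Integration.integrable_diff Xi simp: X_def)
  have fE: "(\<integral> \<omega>. f (X s \<omega>) \<partial>M) = base_stock_cost M D \<tau> h p S" for s
  proof -
    have "(\<integral> \<omega>. f (X s \<omega>) \<partial>M) = (\<integral> x. f x \<partial>distr M borel (X s))" by (subst integral_distr) auto
    also have "distr M borel (X s) = distr M borel (X 0)"
      using distr_sum_shift[OF indep ident, where n = \<tau> and s = s] by (simp add: X_def[abs_def])
    also have "(\<integral> x. f x \<partial>distr M borel (X 0)) = (\<integral> \<omega>. f (X 0 \<omega>) \<partial>M)" by (subst integral_distr) auto
    finally show ?thesis by (simp add: f0)
  qed
  have pos: "0 \<le> f x" for x using assms by (simp add: f_def)
  have cost: "h * max 0 (bo_inv \<tau> S (\<lambda>i. D i \<omega>) t - D t \<omega>)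
      + p * max 0 (D t \<omega> - bo_inv \<tau> S (\<lambda>i. D i \<omega>) t) = f (X (t - \<tau>) \<omega>)" if "\<tau> \<le> t" for t \<omega>
  proof -
    have "X (t - \<tau>) \<omega> = (\<Sum>i = 0..\<tau>. D (i + (t - \<tau>)) \<omega>)"
      unfolding X_def by (rule sum.cong[OF refl]) (simp add: add.commute)
    also have "\<dots> = (\<Sum>i = t - \<tau>..t. D i \<omega>)"
      using sum.shift_bounds_cl_nat_ivl[of "\<lambda>i. D i \<omega>" 0 "t - \<tau>" \<tau>] that by simp
    also have "\<dots> = D t \<omega> + (\<Sum>i = t - \<tau>..<t. D i \<omega>)"
      by (rule sum.last_plus) simp
    finally have "X (t - \<tau>) \<omega> = D t \<omega> + (\<Sum>i = t - \<tau>..<t. D i \<omega>)" .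
    moreover have "bo_inv \<tau> S (\<lambda>i. D i \<omega>) t = S - (\<Sum>i = t - \<tau>..<t. D i \<omega>)"
      using bo_inv_eq[of \<tau> S "\<lambda>i. D i \<omega>" "t - \<tau>"] that by simp
    ultimately have "bo_inv \<tau> S (\<lambda>i. D i \<omega>) t - D t \<omega> = S - X (t - \<tau>) \<omega>"
      "D t \<omega> - bo_inv \<tau> S (\<lambda>i. D i \<omega>) t = X (t - \<tau>) \<omega> - S"
      by linarith+
    then show ?thesis by (simp only: f_def)
  qed
  have "(\<integral>\<^sup>+ \<omega>. ennreal ((1 / (real T - real \<tau> + 1)) *
       (\<Sum>t = \<tau>..T. h * max 0 (bo_inv \<tau> S (\<lambda>i. D i \<omega>) t - D t \<omega>)
                   + p * max 0 (D t \<omega> - bo_inv \<tau> S (\<lambda>i. D i \<omega>) t))) \<partial>M)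
      = ennreal (base_stock_cost M D \<tau> h p S)" if "\<tau> \<le> T" for T
  proof -
    have "(\<integral>\<^sup>+ \<omega>. ennreal ((1 / (real T - real \<tau> + 1)) *
       (\<Sum>t = \<tau>..T. h * max 0 (bo_inv \<tau> S (\<lambda>i. D i \<omega>) t - D t \<omega>)
                   + p * max 0 (D t \<omega> - bo_inv \<tau> S (\<lambda>i. D i \<omega>) t))) \<partial>M)
      = (\<integral>\<^sup>+ \<omega>. ennreal ((1 / (real T - real \<tau> + 1)) * (\<Sum>t = \<tau>..T. f (X (t - \<tau>) \<omega>))) \<partial>M)"
      by (intro nn_integral_cong arg_cong[where f = ennreal] arg_cong2[where f = "(*)"] refl sum.cong)
        (simp add: cost)
    also have "\<dots> = ennreal (\<integral> \<omega>. (1 / (real T - real \<tau> + 1)) * (\<Sum>t = \<tau>..T. f (X (t - \<tau>) \<omega>)) \<partial>M)"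
      using that by (intro nn_integral_eq_integral integrable_mult_right Bochner_Integration.integrable_sum fi)
        (auto intro!: divide_nonneg_nonneg sum_nonneg pos)
    also have "(\<integral> \<omega>. (1 / (real T - real \<tau> + 1)) * (\<Sum>t = \<tau>..T. f (X (t - \<tau>) \<omega>)) \<partial>M)
        = (1 / (real T - real \<tau> + 1)) * (\<Sum>t = \<tau>..T. \<integral> \<omega>. f (X (t - \<tau>) \<omega>) \<partial>M)"
      by (subst integral_mult_right_zero, subst Bochner_Integration.integral_sum) (auto intro: fi)
    also have "\<dots> = base_stock_cost M D \<tau> h p S"
      using that by (simp add: fE of_nat_diff field_simps)
    finally show ?thesis .
  qed
  then have "bo_cost_rate M D \<tau> h p S = limsup (\<lambda>T::nat. ennreal (base_stock_cost M D \<tau> h p S))"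
    unfolding bo_cost_rate_def
    by (intro Limsup_eq eventually_mono[OF eventually_ge_at_top[of \<tau>]]) auto
  then show ?thesis by (simp add: Limsup_const)
qed

lemma newsvendor_right:
  fixes s u x h p :: real
  assumes "u \<le> s" "0 < h" "0 < p"
  shows "(s - u) * ((h + p) * (if x \<le> u then 1 else 0) - p) \<le>
    (h * max 0 (s - x) + p * max 0 (x - s)) - (h * max 0 (u - x) + p * max 0 (x - u))"
proof -
  consider "x \<le> u" | "u < x" "x \<le> s" | "s < x" using assms by linarith
  then show ?thesis
  proof cases
    case 1
    then have "max 0 (s - x) = s - x" "max 0 (x - s) = 0" "max 0 (u - x) = u - x" "max 0 (x - u) = 0"
      using assms by auto
    then show ?thesis using 1 by (simp add: algebra_simps)
  next
    case 2
    then have m: "max 0 (s - x) = s - x" "max 0 (x - s) = 0" "max 0 (u - x) = 0" "max 0 (x - u) = x - u"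
      using assms by auto
    have "0 \<le> (h + p) * (s - x)" using 2 assms by simp
    then show ?thesis using 2 unfolding m by (simp add: algebra_simps)
  next
    case 3
    then have m: "max 0 (s - x) = 0" "max 0 (x - s) = x - s" "max 0 (u - x) = 0" "max 0 (x - u) = x - u"
      using assms by auto
    show ?thesis using 3 assms(1) unfolding m by (simp add: algebra_simps)
  qed
qed

lemma newsvendor_left:
  fixes s u x h p :: real
  assumes "s < u" "0 < h" "0 < p"
  shows "(u - s) * (p - (h + p) * (if x < u then 1 else 0)) \<le>
    (h * max 0 (s - x) + p * max 0 (x - s)) - (h * max 0 (u - x) + p * max 0 (x - u))"
proof -
  consider "x \<le> s" | "s < x" "x < u" | "u \<le> x" using assms by linarith
  then show ?thesis
  proof cases
    case 1
    then have m: "max 0 (s - x) = s - x" "max 0 (x - s) = 0" "max 0 (u - x) = u - x" "max 0 (x - u) = 0"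
      using assms by auto
    show ?thesis using 1 assms(1) unfolding m by (simp add: algebra_simps)
  next
    case 2
    then have m: "max 0 (s - x) = 0" "max 0 (x - s) = x - s" "max 0 (u - x) = u - x" "max 0 (x - u) = 0"
      using assms by auto
    have "0 \<le> (h + p) * (x - s)" using 2 assms by simp
    then show ?thesis using 2 unfolding m by (simp add: algebra_simps)
  next
    case 3
    then have m: "max 0 (s - x) = 0" "max 0 (x - s) = x - s" "max 0 (u - x) = 0" "max 0 (x - u) = x - u"
      using assms by auto
    show ?thesis using 3 assms(1) unfolding m by (simp add: algebra_simps)
  qed
qed

lemma (in prob_space) base_stock_level_optimal:
  fixes D :: "nat \<Rightarrow> 'a \<Rightarrow> real" and h p S :: real and \<tau> :: nat
  assumes D[measurable]: "\<And>i. random_variable borel (D i)"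
    and int: "\<And>i. integrable M (D i)"
    and hp: "0 < h" "0 < p"
  shows "base_stock_cost M D \<tau> h p (base_stock_level M D \<tau> h p) \<le> base_stock_cost M D \<tau> h p S"
proof -
  define X where "X \<omega> = (\<Sum>i = 0..\<tau>. D i \<omega>)" for \<omega>
  have Xm[measurable]: "random_variable borel X" unfolding X_def by measurable
  have Xi: "integrable M X" unfolding X_def using int by simp
  interpret R: real_distribution "distr M borel X" by (rule real_distribution_distr) simp
  define F where "F = cdf (distr M borel X)"
  have F: "F s = prob {\<omega> \<in> space M. X \<omega> \<le> s}" for s
    unfolding F_def cdf_def by (subst measure_distr) (auto intro!: arg_cong[where f = prob])
  define r where "r = p / (p + h)"
  have r: "0 < r" "r < 1" using hp by (auto simp: r_def)
  define Z where "Z = {s. r \<le> F s}"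
  define s0 where "s0 = base_stock_level M D \<tau> h p"
  have s0: "s0 = Inf Z"
    by (simp add: s0_def Z_def r_def F X_def base_stock_level_def)
  have mono: "F a \<le> F b" if "a \<le> b" for a b
    unfolding F_def using that by (rule R.cdf_nondecreasing)
  have "eventually (\<lambda>s. r < F s) at_top"
    unfolding F_def using R.cdf_lim_at_top_prob r by (auto dest: order_tendstoD)
  then have ne: "Z \<noteq> {}" using eventually_happens[of "\<lambda>s. r < F s" at_top] by (auto simp: Z_def intro: less_imp_le)
  have "eventually (\<lambda>s. F s < r) at_bot"
    unfolding F_def using R.cdf_lim_at_bot r by (auto dest: order_tendstoD)
  then obtain b where b: "\<And>s. s \<le> b \<Longrightarrow> F s < r" by (auto simp: eventually_at_bot_linorder)
  have bdd: "bdd_below Z"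
  proof (rule bdd_belowI[of _ b])
    fix z assume "z \<in> Z"
    then show "b \<le> z" using b[of z] by (cases "z \<le> b") (auto simp: Z_def)
  qed
  have up: "r \<le> F s" if less: "s0 < s" for s
  proof -
    obtain z where "z \<in> Z" "z < s" using cInf_lessD[OF ne, of s] less s0 by auto
    then show ?thesis using mono[of z s] by (simp add: Z_def)
  qed
  have lo: "F s < r" if "s < s0" for s
    using that cInf_lower[OF _ bdd, of s] by (cases "r \<le> F s") (auto simp: s0 Z_def)
  define G where "G s \<omega> = h * max 0 (s - X \<omega>) + p * max 0 (X \<omega> - s)" for s \<omega>
  have Gi: "integrable M (G s)" for s
    unfolding G_def by (intro Bochner_Integration.integrable_add integrable_mult_right
        integrable_max Bochner_Integration.integrable_diff Xi) auto
  have GE: "base_stock_cost M D \<tau> h p s = (\<integral> \<omega>. G s \<omega> \<partial>M)" for s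
    unfolding G_def base_stock_cost_def X_def[symmetric]
    by (subst Bochner_Integration.integral_add)
      (auto intro!: integrable_mult_right integrable_max Bochner_Integration.integrable_diff Xi)
  show ?thesis
  proof (cases "s0 \<le> S")
    case True
    let ?A = "{\<omega> \<in> space M. X \<omega> \<le> s0}"
    have iA: "integrable M (indicator ?A :: 'a \<Rightarrow> real)"
      by (rule integrable_real_indicator) (simp_all add: less_top[symmetric])
    then have iB: "integrable M (\<lambda>\<omega>. (h + p) * indicator ?A \<omega> :: real)"
      by (rule integrable_mult_right)
    then have iL: "integrable M (\<lambda>\<omega>. (S - s0) * ((h + p) * indicator ?A \<omega> - p))"
      by (intro integrable_mult_right Bochner_Integration.integrable_diff) simp_all
    have iR: "integrable M (\<lambda>\<omega>. G S \<omega> - G s0 \<omega>)"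
      by (rule Bochner_Integration.integrable_diff[OF Gi Gi])
    have "(F \<longlongrightarrow> F s0) (at_right s0)"
      using R.cdf_is_right_cont[of s0] by (simp add: F_def continuous_within)
    then have "r \<le> F s0"
    proof (rule tendsto_lowerbound)
      show "eventually (\<lambda>s. r \<le> F s) (at_right s0)"
        using eventually_at_right_less[of s0] by (rule eventually_mono) (rule up)
    qed simp
    then have "0 \<le> (S - s0) * ((h + p) * prob ?A - p)"
      using True hp by (intro mult_nonneg_nonneg) (auto simp: r_def F field_simps)
    also have "\<dots> = (\<integral> \<omega>. (S - s0) * ((h + p) * indicator ?A \<omega> - p) \<partial>M)"
      using iB by (simp add: prob_space Int_absorb2)
    also have "\<dots> \<le> (\<integral> \<omega>. G S \<omega> - G s0 \<omega> \<partial>M)"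
    proof (rule Bochner_Integration.integral_mono[OF iL iR])
      fix \<omega> assume "\<omega> \<in> space M"
      show "(S - s0) * ((h + p) * indicator ?A \<omega> - p) \<le> G S \<omega> - G s0 \<omega>"
        using newsvendor_right[OF True hp, of "X \<omega>"] \<open>\<omega> \<in> space M\<close>
        unfolding G_def by (cases "X \<omega> \<le> s0") auto
    qed
    also have "\<dots> = (\<integral> \<omega>. G S \<omega> \<partial>M) - (\<integral> \<omega>. G s0 \<omega> \<partial>M)"
      by (rule Bochner_Integration.integral_diff[OF Gi Gi])
    finally show ?thesis unfolding GE s0_def[symmetric] by linarith
  next
    case False
    let ?A = "{\<omega> \<in> space M. X \<omega> < s0}"
    have iA: "integrable M (indicator ?A :: 'a \<Rightarrow> real)"
      by (rule integrable_real_indicator) (simp_all add: less_top[symmetric])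
    then have iB: "integrable M (\<lambda>\<omega>. (h + p) * indicator ?A \<omega> :: real)"
      by (rule integrable_mult_right)
    then have iL: "integrable M (\<lambda>\<omega>. (s0 - S) * (p - (h + p) * indicator ?A \<omega>))"
      by (intro integrable_mult_right Bochner_Integration.integrable_diff) simp_all
    have iR: "integrable M (\<lambda>\<omega>. G S \<omega> - G s0 \<omega>)"
      by (rule Bochner_Integration.integrable_diff[OF Gi Gi])
    have "prob ?A = measure (distr M borel X) {..<s0}"
      by (subst measure_distr) (auto intro!: arg_cong[where f = prob])
    moreover have "(F \<longlongrightarrow> measure (distr M borel X) {..<s0}) (at_left s0)"
      unfolding F_def by (rule R.cdf_at_left)
    then have "measure (distr M borel X) {..<s0} \<le> r"
    proof (rule tendsto_upperbound)
      show "eventually (\<lambda>s. F s \<le> r) (at_left s0)"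
        using eventually_at_left_real[of "s0 - 1" s0] by (auto elim!: eventually_mono dest: lo)
    qed simp
    ultimately have "prob ?A \<le> r" by simp
    then have "0 \<le> (s0 - S) * (p - (h + p) * prob ?A)"
      using False hp by (intro mult_nonneg_nonneg) (auto simp: r_def field_simps)
    also have "\<dots> = (\<integral> \<omega>. (s0 - S) * (p - (h + p) * indicator ?A \<omega>) \<partial>M)"
      using iB by (simp add: prob_space Int_absorb2)
    also have "\<dots> \<le> (\<integral> \<omega>. G S \<omega> - G s0 \<omega> \<partial>M)"
    proof (rule Bochner_Integration.integral_mono[OF iL iR])
      fix \<omega> assume "\<omega> \<in> space M"
      show "(s0 - S) * (p - (h + p) * indicator ?A \<omega>) \<le> G S \<omega> - G s0 \<omega>"
        using newsvendor_left[OF _ hp, of S s0 "X \<omega>"] False \<open>\<omega> \<in> space M\<close>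
        unfolding G_def by (cases "X \<omega> < s0") auto
    qed
    also have "\<dots> = (\<integral> \<omega>. G S \<omega> \<partial>M) - (\<integral> \<omega>. G s0 \<omega> \<partial>M)"
      by (rule Bochner_Integration.integral_diff[OF Gi Gi])
    finally show ?thesis unfolding GE s0_def[symmetric] by linarith
  qed
qed

end

theory Submission
  imports Defs
begin

text \<open>
  Under a PIL policy with level \<open>U\<close> every order satisfies $q_{t+\tau} = U - E[J_{t+\tau-1} \mid
  \mathbf{x}_t]$ without truncation, so that $E[I_{t+\tau} \mid \mathbf{x}_t] = U$, which is also
  the mean of $I^B_{t+\tau}$ under the base-stock policy with level $U + \tau\mu$. Taking a
  positive part and centring decreases a random variable in the convex order, and this order is
  preserved by adding independent variables. Hence, by induction over the lead time,
  $I_{t+\tau}$ given $\mathbf{x}_t$ is below $I^B_{t+\tau}$ in the convex order, and the expected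
  cost of every single period is at most that of the back-order system. If $S^* < \tau\mu$, then
  the policy never orders and costs $p\mu$ per period, which is below
  $p\,E[D[0,\tau] - S^*] \le C^{B*}$.
\<close>

section \<open>Stop-loss order and independence\<close>

context prob_space
begin

text \<open>
  For equal means this is the convex order. Since \<open>ennreal\<close> sends negative numbers to \<open>0\<close>, the
  integrands are the positive parts of \<open>X - a\<close> and \<open>Y - a\<close>.
\<close>

definition stop_loss_le :: "('a \<Rightarrow> real) \<Rightarrow> ('a \<Rightarrow> real) \<Rightarrow> bool" where
  "stop_loss_le X Y \<longleftrightarrow>
    (\<forall>a. (\<integral>\<^sup>+ \<omega>. ennreal (X \<omega> - a) \<partial>M) \<le> (\<integral>\<^sup>+ \<omega>. ennreal (Y \<omega> - a) \<partial>M))"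

lemma stop_loss_le_refl: "stop_loss_le X X"
  by (simp add: stop_loss_le_def)

lemma stop_loss_le_trans: "stop_loss_le X Y \<Longrightarrow> stop_loss_le Y Z \<Longrightarrow> stop_loss_le X Z"
  unfolding stop_loss_le_def by (meson order_trans)

lemma nn_integral_excess:
  assumes "integrable M X"
  shows "(\<integral>\<^sup>+ \<omega>. ennreal (X \<omega> - a) \<partial>M) = ennreal (\<integral> \<omega>. max 0 (X \<omega> - a) \<partial>M)"
proof -
  have "(\<integral>\<^sup>+ \<omega>. ennreal (X \<omega> - a) \<partial>M) = (\<integral>\<^sup>+ \<omega>. ennreal (max 0 (X \<omega> - a)) \<partial>M)"
    by (intro nn_integral_cong) (auto simp: max_def ennreal_neg)
  also have "\<dots> = ennreal (\<integral> \<omega>. max 0 (X \<omega> - a) \<partial>M)"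
    using assms by (intro nn_integral_eq_integral) auto
  finally show ?thesis .
qed

lemma stop_loss_le_iff:
  assumes "integrable M X" "integrable M Y"
  shows "stop_loss_le X Y \<longleftrightarrow>
    (\<forall>a. (\<integral> \<omega>. max 0 (X \<omega> - a) \<partial>M) \<le> (\<integral> \<omega>. max 0 (Y \<omega> - a) \<partial>M))"
  unfolding stop_loss_le_def nn_integral_excess[OF assms(1)] nn_integral_excess[OF assms(2)]
  by (simp add: Bochner_Integration.integral_nonneg)

text \<open>
  The centred negative part of \<open>Y\<close> is comonotone with the centred positive part, so that
  adding it can only increase the expectation of a convex function; pointwise, this is the
  subgradient inequality with the slope \<open>c\<close> at the lowest value of the centred positive part.
\<close>

lemma stop_loss_le_pos_part:
  assumes Y: "integrable M Y"
  shows "stop_loss_le (\<lambda>\<omega>. max 0 (Y \<omega>) - (\<integral> \<omega>. max 0 (Y \<omega>) \<partial>M)) (\<lambda>\<omega>. Y \<omega> - (\<integral> \<omega>. Y \<omega> \<partial>M))"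
proof -
  define m where "m = (\<integral> \<omega>. max 0 (Y \<omega>) \<partial>M)"
  define n where "n = m - (\<integral> \<omega>. Y \<omega> \<partial>M)"
  have iP: "integrable M (\<lambda>\<omega>. max 0 (Y \<omega>))" using Y by auto
  have n0: "0 \<le> n"
    unfolding n_def m_def using Bochner_Integration.integral_mono[OF Y iP] by simp
  have "(\<integral> \<omega>. max 0 (max 0 (Y \<omega>) - m - a) \<partial>M) \<le> (\<integral> \<omega>. max 0 (Y \<omega> - (m - n) - a) \<partial>M)" for a
  proof -
    define c :: real where "c = (if a < - m then 1 else 0)"
    have i1: "integrable M (\<lambda>\<omega>. max 0 (max 0 (Y \<omega>) - m - a))" using iP by auto
    have i2: "integrable M (\<lambda>\<omega>. c * (n - (max 0 (Y \<omega>) - Y \<omega>)))"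
      using iP Y by (intro integrable_mult_right Bochner_Integration.integrable_diff) auto
    have i3: "integrable M (\<lambda>\<omega>. max 0 (Y \<omega> - (m - n) - a))" using Y by auto
    have "(\<integral> \<omega>. n - (max 0 (Y \<omega>) - Y \<omega>) \<partial>M) = 0"
      using iP Y by (simp add: n_def m_def prob_space)
    then have "(\<integral> \<omega>. max 0 (max 0 (Y \<omega>) - m - a) \<partial>M) =
        (\<integral> \<omega>. max 0 (max 0 (Y \<omega>) - m - a) + c * (n - (max 0 (Y \<omega>) - Y \<omega>)) \<partial>M)"
      using i1 i2 by simp
    also have "\<dots> \<le> (\<integral> \<omega>. max 0 (Y \<omega> - (m - n) - a) \<partial>M)"
      by (rule Bochner_Integration.integral_mono[OF Bochner_Integration.integrable_add[OF i1 i2] i3])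
        (use n0 in \<open>auto simp: c_def max_def\<close>)
    finally show ?thesis .
  qed
  moreover have "m - n = (\<integral> \<omega>. Y \<omega> \<partial>M)" by (simp add: n_def)
  ultimately show ?thesis
    using Y iP by (subst stop_loss_le_iff) (auto simp: m_def)
qed

text \<open>This is Fubini for the product of the two laws, pulled back to \<open>M\<close>. A
  second sample point serves as an independent copy, so conditioning on \<open>X\<close> becomes
  fixing the outer point of an iterated integral over the original space.\<close>

lemma nn_integral_indep_var:
  assumes ind: "indep_var S X T Y" and f[measurable]: "f \<in> borel_measurable (S \<Otimes>\<^sub>M T)"
  shows "(\<integral>\<^sup>+ \<omega>. f (X \<omega>, Y \<omega>) \<partial>M) = (\<integral>\<^sup>+ \<omega>. \<integral>\<^sup>+ \<omega>'. f (X \<omega>, Y \<omega>') \<partial>M \<partial>M)"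
proof -
  have X[measurable]: "X \<in> measurable M S" and Y[measurable]: "Y \<in> measurable M T"
    and XY: "distr M S X \<Otimes>\<^sub>M distr M T Y = distr M (S \<Otimes>\<^sub>M T) (\<lambda>\<omega>. (X \<omega>, Y \<omega>))"
    using ind by (auto simp: indep_var_distribution_eq)
  interpret PY: prob_space "distr M T Y" by (rule prob_space_distr) simp
  have f': "f \<in> borel_measurable (distr M S X \<Otimes>\<^sub>M distr M T Y)"
    using f by (subst measurable_cong_sets[OF sets_pair_measure_cong refl]) auto
  have "(\<integral>\<^sup>+ \<omega>. f (X \<omega>, Y \<omega>) \<partial>M) = (\<integral>\<^sup>+ z. f z \<partial>(distr M S X \<Otimes>\<^sub>M distr M T Y))"
    unfolding XY by (subst nn_integral_distr) auto
  also have "\<dots> = (\<integral>\<^sup>+ x. \<integral>\<^sup>+ y. f (x, y) \<partial>distr M T Y \<partial>distr M S X)"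
    by (rule PY.nn_integral_fst[OF f', symmetric])
  also have "\<dots> = (\<integral>\<^sup>+ \<omega>. \<integral>\<^sup>+ y. f (X \<omega>, y) \<partial>distr M T Y \<partial>M)"
    by (rule nn_integral_distr[OF X]) (use PY.borel_measurable_nn_integral_fst[OF f'] in simp)
  also have "\<dots> = (\<integral>\<^sup>+ \<omega>. \<integral>\<^sup>+ \<omega>'. f (X \<omega>, Y \<omega>') \<partial>M \<partial>M)"
    by (intro nn_integral_cong nn_integral_distr[OF Y]) (use measurable_space[OF X] in measurable)
  finally show ?thesis .
qed

text \<open>For a fixed value of \<open>Z\<close> the summand only moves the threshold from
  \<open>a\<close> to \<open>a - Z\<close>, and the hypothesis covers all thresholds. Independence
  allows \<open>Z\<close> to be integrated last.\<close>

lemma stop_loss_le_add_indep: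
  assumes X: "indep_var borel Z borel X" and Y: "indep_var borel Z borel Y"
    and le: "stop_loss_le X Y"
  shows "stop_loss_le (\<lambda>\<omega>. X \<omega> + Z \<omega>) (\<lambda>\<omega>. Y \<omega> + Z \<omega>)"
  unfolding stop_loss_le_def
proof
  fix a
  have m: "(\<lambda>z. ennreal (snd z - (a - fst z))) \<in> borel_measurable (borel \<Otimes>\<^sub>M borel)"
    by measurable
  have "(\<integral>\<^sup>+ \<omega>. ennreal (X \<omega> - (a - Z \<omega>)) \<partial>M) \<le> (\<integral>\<^sup>+ \<omega>. ennreal (Y \<omega> - (a - Z \<omega>)) \<partial>M)"
    using nn_integral_indep_var[OF X m] nn_integral_indep_var[OF Y m] le
    by (simp add: stop_loss_le_def nn_integral_mono)
  then show "(\<integral>\<^sup>+ \<omega>. ennreal (X \<omega> + Z \<omega> - a) \<partial>M) \<le> (\<integral>\<^sup>+ \<omega>. ennreal (Y \<omega> + Z \<omega> - a) \<partial>M)"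
    by (simp add: algebra_simps)
qed

text \<open>The cost is \<open>(h + p) * max 0 (X - a) - p * (X - a)\<close>. Equal means make the
  linear part the same for \<open>X\<close> and \<open>Y\<close>, which leaves a nonnegative
  multiple of a stop-loss expectation.\<close>

lemma newsvendor_cost_mono:
  assumes le: "stop_loss_le X Y" and int: "integrable M X" "integrable M Y"
    and mean: "(\<integral> \<omega>. X \<omega> \<partial>M) = (\<integral> \<omega>. Y \<omega> \<partial>M)" and hp: "0 \<le> h" "0 \<le> p"
  shows "(\<integral> \<omega>. h * max 0 (X \<omega> - a) + p * max 0 (a - X \<omega>) \<partial>M)
    \<le> (\<integral> \<omega>. h * max 0 (Y \<omega> - a) + p * max 0 (a - Y \<omega>) \<partial>M)"
proof -
  have *: "(\<integral> \<omega>. h * max 0 (X \<omega> - a) + p * max 0 (a - X \<omega>) \<partial>M) =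
      (h + p) * (\<integral> \<omega>. max 0 (X \<omega> - a) \<partial>M) - p * ((\<integral> \<omega>. X \<omega> \<partial>M) - a)"
    if "integrable M X" for X
  proof -
    have "(\<integral> \<omega>. h * max 0 (X \<omega> - a) + p * max 0 (a - X \<omega>) \<partial>M) =
        (\<integral> \<omega>. (h + p) * max 0 (X \<omega> - a) - p * (X \<omega> - a) \<partial>M)"
      by (intro Bochner_Integration.integral_cong) (auto simp: max_def algebra_simps)
    also have "\<dots> = (\<integral> \<omega>. (h + p) * max 0 (X \<omega> - a) \<partial>M) - (\<integral> \<omega>. p * (X \<omega> - a) \<partial>M)"
      using that by (intro Bochner_Integration.integral_diff integrable_mult_right) auto
    also have "\<dots> = (h + p) * (\<integral> \<omega>. max 0 (X \<omega> - a) \<partial>M) - p * ((\<integral> \<omega>. X \<omega> \<partial>M) - a)"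
      using that by (simp add: prob_space)
    finally show ?thesis .
  qed
  have "(h + p) * (\<integral> \<omega>. max 0 (X \<omega> - a) \<partial>M) \<le> (h + p) * (\<integral> \<omega>. max 0 (Y \<omega> - a) \<partial>M)"
    using le hp int by (intro mult_left_mono) (auto simp: stop_loss_le_iff)
  then show ?thesis unfolding *[OF int(1)] *[OF int(2)] mean by simp
qed

lemma nn_integral_merge:
  fixes D :: "nat \<Rightarrow> 'a \<Rightarrow> real"
  assumes indep: "indep_vars (\<lambda>_. borel) D UNIV"
    and f: "f \<in> borel_measurable (PiM UNIV (\<lambda>_. borel))"
  shows "(\<integral>\<^sup>+ \<omega>. f (\<lambda>i. D i \<omega>) \<partial>M) =
    (\<integral>\<^sup>+ \<omega>. \<integral>\<^sup>+ \<omega>'. f (\<lambda>i. if i < s then D i \<omega> else D i \<omega>') \<partial>M \<partial>M)"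
proof -
  define V where "V \<omega> = (\<lambda>i\<in>{..<s}. D i \<omega>)" for \<omega>
  define W where "W \<omega> = (\<lambda>i\<in>{s..}. D i \<omega>)" for \<omega>
  have ind: "indep_var (PiM {..<s} (\<lambda>_. borel)) V (PiM {s..} (\<lambda>_. borel)) W"
    unfolding V_def W_def by (rule indep_var_restrict[OF indep]) auto
  have "{..<s} \<union> {s..} = (UNIV :: nat set)" by auto
  then have m: "(\<lambda>z. f (merge {..<s} {s..} z)) \<in> borel_measurable
      (PiM {..<s} (\<lambda>_. borel) \<Otimes>\<^sub>M PiM {s..} (\<lambda>_. borel))"
    using measurable_compose[OF measurable_merge[of "{..<s}" "{s..}" "\<lambda>_. borel"], of f] f by simp
  have e: "merge {..<s} {s..} (V \<omega>, W \<omega>') = (\<lambda>i. if i < s then D i \<omega> else D i \<omega>')" for \<omega> \<omega>'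
    by (auto simp: merge_def V_def W_def fun_eq_iff)
  show ?thesis
    using nn_integral_indep_var[OF ind m] by (simp add: e)
qed

end

section \<open>The i.i.d. demand process and its time shifts\<close>

locale iid_demand = prob_space M for M :: "'a measure" +
  fixes D :: "nat \<Rightarrow> 'a \<Rightarrow> real" and \<mu> :: real
  assumes indep: "indep_vars (\<lambda>_. borel) D UNIV"
    and ident: "\<And>t. distr M borel (D t) = distr M borel (D 0)"
    and nonneg: "\<And>t \<omega>. \<omega> \<in> space M \<Longrightarrow> 0 \<le> D t \<omega>"
    and integrable_D0: "integrable M (D 0)"
    and mean: "\<mu> = (\<integral> \<omega>. D 0 \<omega> \<partial>M)"
begin

lemma D_measurable[measurable]: "random_variable borel (D i)"
  using indep by (auto simp: indep_vars_def)

lemma integrable_D[simp]: "integrable M (D i)"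
proof -
  have "integrable (distr M borel (D i)) (\<lambda>x. x)"
    unfolding ident[of i] by (subst integrable_distr_eq) (auto simp: integrable_D0)
  then show ?thesis by (subst (asm) integrable_distr_eq) auto
qed

lemma expectation_D[simp]: "(\<integral> \<omega>. D i \<omega> \<partial>M) = \<mu>"
proof -
  have "(\<integral> \<omega>. D i \<omega> \<partial>M) = (\<integral> x. x \<partial>distr M borel (D i))" for i
    by (subst integral_distr) auto
  from this[of i] this[of 0] show ?thesis by (simp add: ident[of i] mean)
qed

text \<open>Both laws are the countable power of the law of \<open>D 0\<close>, because any shifted
  subfamily is again independent with the same marginals.\<close>

lemma distr_shift:
  "distr M (PiM UNIV (\<lambda>_. borel)) (\<lambda>\<omega> i. D (s + i) \<omega>) = distr M (PiM UNIV (\<lambda>_. borel)) (\<lambda>\<omega> i. D i \<omega>)"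
proof -
  have "distr M (PiM UNIV (\<lambda>_. borel)) (\<lambda>\<omega> i. D (s + i) \<omega>) = PiM UNIV (\<lambda>_. distr M borel (D 0))" for s
  proof -
    have "indep_vars (\<lambda>j. PiM {s + j} (\<lambda>_. borel)) (\<lambda>j \<omega>. restrict (\<lambda>i. D i \<omega>) {s + j}) UNIV"
      by (rule indep_vars_restrict[OF indep]) (auto simp: disjoint_family_on_def)
    then have "indep_vars (\<lambda>_. borel) (\<lambda>j. (\<lambda>f. f (s + j)) \<circ> (\<lambda>\<omega>. restrict (\<lambda>i. D i \<omega>) {s + j})) UNIV"
      by (rule indep_vars_compose) auto
    then have "indep_vars (\<lambda>_. borel) (\<lambda>j. D (s + j)) UNIV"
      by (simp add: comp_def)
    then have "distr M (PiM UNIV (\<lambda>_. borel)) (\<lambda>\<omega> i. D (s + i) \<omega>) =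
        PiM UNIV (\<lambda>i. distr M borel (D (s + i)))"
      by (subst (asm) indep_vars_iff_distr_eq_PiM') (auto simp: restrict_def)
    also have "\<dots> = PiM UNIV (\<lambda>_. distr M borel (D 0))"
      by (rule PiM_cong[OF refl ident])
    finally show ?thesis .
  qed
  from this[of s] this[of 0] show ?thesis by simp
qed

lemma integral_shift:
  fixes f :: "(nat \<Rightarrow> real) \<Rightarrow> real"
  assumes "f \<in> borel_measurable (PiM UNIV (\<lambda>_. borel))"
  shows "(\<integral> \<omega>. f (\<lambda>i. D (s + i) \<omega>) \<partial>M) = (\<integral> \<omega>. f (\<lambda>i. D i \<omega>) \<partial>M)"
proof -
  have "(\<integral> \<omega>. f (\<lambda>i. D (s + i) \<omega>) \<partial>M) =
      integral\<^sup>L (distr M (PiM UNIV (\<lambda>_. borel)) (\<lambda>\<omega> i. D (s + i) \<omega>)) f" for s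
    by (rule integral_distr[symmetric, OF _ assms]) (rule measurable_PiM_single', auto)
  from this[of s] this[of 0] show ?thesis by (simp add: distr_shift[of s])
qed

section \<open>Comparison of lost sales and back-order inventory\<close>

lemma end_inv_from_shift:
  "(\<integral> \<omega>. end_inv_from x (\<lambda>i. D (s + i) \<omega>) k \<partial>M) = (\<integral> \<omega>. end_inv_from x (\<lambda>i. D i \<omega>) k \<partial>M)"
  by (intro integral_shift[of "\<lambda>d. end_inv_from x d k"] end_inv_from_measurable) auto

lemma integrable_end_inv_from: "integrable M (\<lambda>\<omega>. end_inv_from x (\<lambda>i. D (s + i) \<omega>) k)"
  by (induction k) auto

text \<open>The demand of period \<open>s + Suc k\<close> is independent of the block of demands
  that determines both sides, so its centred negative can be added to each. On the right it is
  exactly the next term of the sum. This advances the induction over the lead time and later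
  accounts for the demand of the arrival period itself.\<close>

lemma stop_loss_le_minus_demand:
  assumes "stop_loss_le (\<lambda>\<omega>. end_inv_from x (\<lambda>i. D (s + i) \<omega>) k - c)
      (\<lambda>\<omega>. real (Suc k) * \<mu> - (\<Sum>i\<le>k. D (s + i) \<omega>))"
  shows "stop_loss_le (\<lambda>\<omega>. end_inv_from x (\<lambda>i. D (s + i) \<omega>) k - c + (\<mu> - D (s + Suc k) \<omega>))
      (\<lambda>\<omega>. real (Suc (Suc k)) * \<mu> - (\<Sum>i\<le>Suc k. D (s + i) \<omega>))"
proof -
  let ?P = "\<lambda>I. PiM I (\<lambda>_. borel :: real measure)"
  let ?A = "{s + Suc k}" and ?B = "{s..s + k}"
  have ind: "indep_var (?P ?A) (\<lambda>\<omega>. \<lambda>i\<in>?A. D i \<omega>) (?P ?B) (\<lambda>\<omega>. \<lambda>i\<in>?B. D i \<omega>)"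
    by (rule indep_var_restrict[OF indep]) auto
  have fut: "indep_var borel (\<lambda>\<omega>. \<mu> - D (s + Suc k) \<omega>) borel (\<lambda>\<omega>. g (\<lambda>i\<in>?B. D i \<omega>))"
    if g: "g \<in> borel_measurable (?P ?B)" for g :: "(nat \<Rightarrow> real) \<Rightarrow> real"
    using indep_var_compose[OF ind _ g, of "\<lambda>v. \<mu> - v (s + Suc k)" borel] by (simp add: comp_def)
  \<comment> \<open>Up to step \<open>k\<close> the recursion reads only demands in
    \<open>?B\<close>, so it is a function of the restricted path and inherits its
    independence.\<close>
  have cong: "end_inv_from x (\<lambda>i. (\<lambda>i\<in>?B. D i \<omega>) (s + i)) j = end_inv_from x (\<lambda>i. D (s + i) \<omega>) j"
    if "j \<le> k" for j \<omega>
    using that by (induction j) auto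
  have 1: "indep_var borel (\<lambda>\<omega>. \<mu> - D (s + Suc k) \<omega>) borel (\<lambda>\<omega>. end_inv_from x (\<lambda>i. D (s + i) \<omega>) k - c)"
  proof -
    have "(\<lambda>w. end_inv_from x (\<lambda>i. w (s + i)) k - c) \<in> borel_measurable (?P ?B)"
      by (intro borel_measurable_diff end_inv_from_measurable) auto
    from fut[OF this] show ?thesis by (simp only: cong[OF le_refl])
  qed
  have 2: "indep_var borel (\<lambda>\<omega>. \<mu> - D (s + Suc k) \<omega>) borel (\<lambda>\<omega>. real (Suc k) * \<mu> - (\<Sum>i\<le>k. D (s + i) \<omega>))"
    using fut[of "\<lambda>w. real (Suc k) * \<mu> - (\<Sum>i\<le>k. w (s + i))"] by simp
  show ?thesis
    using stop_loss_le_add_indep[OF 1 2 assms] by (simp add: algebra_simps)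
qed

text \<open>The right-hand side is the centred net inventory when shortages are back-ordered. In
  each step \<open>stop_loss_le_pos_part\<close> removes the truncation at zero, the deterministic
  receipt \<open>x ! Suc k\<close> cancels by centring, and the remaining demand term is handled by
  \<open>stop_loss_le_minus_demand\<close>.\<close>

lemma stop_loss_le_end_inv_from:
  "stop_loss_le (\<lambda>\<omega>. end_inv_from x (\<lambda>i. D (s + i) \<omega>) k - (\<integral> \<omega>. end_inv_from x (\<lambda>i. D (s + i) \<omega>) k \<partial>M))
    (\<lambda>\<omega>. real (Suc k) * \<mu> - (\<Sum>i\<le>k. D (s + i) \<omega>))"
proof (induction k)
  case 0
  have "stop_loss_le (\<lambda>\<omega>. max 0 (x ! 0 - D s \<omega>) - (\<integral> \<omega>. max 0 (x ! 0 - D s \<omega>) \<partial>M))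
      (\<lambda>\<omega>. x ! 0 - D s \<omega> - (\<integral> \<omega>. x ! 0 - D s \<omega> \<partial>M))"
    by (rule stop_loss_le_pos_part) auto
  then show ?case by (simp add: prob_space)
next
  case (Suc k)
  define J where "J \<omega> = end_inv_from x (\<lambda>i. D (s + i) \<omega>) k" for \<omega>
  have J: "integrable M J" unfolding J_def by (rule integrable_end_inv_from)
  have "stop_loss_le (\<lambda>\<omega>. max 0 (J \<omega> + x ! Suc k - D (s + Suc k) \<omega>)
        - (\<integral> \<omega>. max 0 (J \<omega> + x ! Suc k - D (s + Suc k) \<omega>) \<partial>M))
      (\<lambda>\<omega>. J \<omega> + x ! Suc k - D (s + Suc k) \<omega> - (\<integral> \<omega>. J \<omega> + x ! Suc k - D (s + Suc k) \<omega> \<partial>M))"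
    using J by (intro stop_loss_le_pos_part) auto
  also have "(\<lambda>\<omega>. J \<omega> + x ! Suc k - D (s + Suc k) \<omega> - (\<integral> \<omega>. J \<omega> + x ! Suc k - D (s + Suc k) \<omega> \<partial>M))
      = (\<lambda>\<omega>. J \<omega> - (\<integral> \<omega>. J \<omega> \<partial>M) + (\<mu> - D (s + Suc k) \<omega>))"
    using J by (simp add: prob_space fun_eq_iff)
  finally show ?case
    using stop_loss_le_minus_demand[OF Suc.IH] unfolding J_def
    by (auto intro: stop_loss_le_trans)
qed

section \<open>Absence of truncation in PIL orders\<close>

lemma pil_policy_measurable:
  assumes "\<And>k. k < max 1 \<tau> \<Longrightarrow> (\<lambda>\<omega>. x \<omega> ! k) \<in> borel_measurable N"
  shows "(\<lambda>\<omega>. pil_policy M D \<tau> U t (x \<omega>)) \<in> borel_measurable N"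
  unfolding pil_policy_def
  by (intro borel_measurable_max borel_measurable_diff borel_measurable_const
      proj_end_inv_measurable D_measurable assms)

lemma ls_inv_pil_measurable:
  "(\<lambda>d. ls_inv \<tau> (pil_policy M D \<tau> U) d t) \<in> borel_measurable (PiM UNIV (\<lambda>_. borel))"
  using ls_measurable_aux[where A = "pil_policy M D \<tau> U" and \<tau> = \<tau> and N = "PiM UNIV (\<lambda>_. borel)"
      and d = "\<lambda>d. d" and n = t and s = t, OF pil_policy_measurable] by auto

text \<open>
  By induction, the orders are not truncated, so an order equals \<open>U\<close> minus the projected
  inventory. If no demand occurs, then moving from period \<open>t\<close> to \<open>t + 1\<close> amounts to receiving
  every order one period earlier, which raises the inventory by at most the last order.
\<close>

lemma proj_end_inv_pil_le:
  assumes U: "0 \<le> U" and d: "\<And>i. 0 \<le> d i"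
  shows "proj_end_inv M D \<tau> t (ls_state \<tau> (pil_policy M D \<tau> U) d t) \<le> U"
proof (induction t)
  let ?A = "pil_policy M D \<tau> U"
  let ?x = "ls_state \<tau> ?A d"
  case 0
  show ?case
  proof (cases "\<tau> = 0")
    case True
    then show ?thesis using U by (simp add: proj_end_inv_def ls_state.simps ls_carry.simps)
  next
    case False
    have x: "?x 0 ! i = 0" if "i < \<tau>" for i
      using that False
      by (cases i) (auto simp: ls_state.simps ls_inv.simps ls_carry.simps ls_order.simps)
    have "end_inv_from (?x 0) (\<lambda>i. D i \<omega>) k = 0" if "\<omega> \<in> space M" "k < \<tau>" for k \<omega>
      using that(2) by (induction k) (auto simp: x nonneg that(1))
    then have "proj_end_inv M D \<tau> 0 (?x 0) = (\<integral> \<omega>. 0 \<partial>M)"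
      using False by (simp add: proj_end_inv_def cong: Bochner_Integration.integral_cong)
    then show ?thesis using U by simp
  qed
next
  let ?A = "pil_policy M D \<tau> U"
  let ?x = "ls_state \<tau> ?A d" and ?q = "ls_order \<tau> ?A d"
  case (Suc t)
  have order: "?q (t + \<tau>) = U - proj_end_inv M D \<tau> t (?x t)"
    using Suc by (simp add: ls_order.simps pil_policy_def[of _ _ _ _ t])
  show ?case
  proof (cases "\<tau> = 0")
    case True
    then show ?thesis
      using order Suc U d[of t]
      by (simp add: proj_end_inv_def ls_state.simps ls_carry.simps[of _ _ _ "Suc t"] ls_inv.simps)
  next
    case False
    have x0: "?x (Suc t) ! 0 \<le> ?x t ! 0 + ?q (Suc t)" "0 \<le> ?x t ! 0"
      using False ls_carry_nonneg[of \<tau> ?A d t] ls_order_pil[OF U, of \<tau> M D d t] d[of t]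
      by (auto simp: ls_state.simps ls_inv.simps[of _ _ _ "Suc t"] ls_carry.simps[of _ _ _ "Suc t"]
          ls_inv.simps[of _ _ _ t])
    have xS: "?x (Suc t) ! Suc k = ?q (t + Suc (Suc k))" "?x t ! Suc k = ?q (t + Suc k)"
      if "Suc k < \<tau>" for k
      using that by (auto simp: ls_state.simps simp del: upt_Suc)
    \<comment> \<open>The surplus \<open>?q (t + Suc k)\<close> is the receipt
      \<open>?x t ! Suc k\<close> that the other system gets one step later. After that step the two
      differ by at most the next order, and at \<open>k = \<tau> - 1\<close> this is the order
      placed in period \<open>t\<close>.\<close>
    have le: "end_inv_from (?x (Suc t)) e k \<le> end_inv_from (?x t) e k + ?q (t + Suc k)"
      if "k < \<tau>" for e k
      using that
    proof (induction k)
      case 0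
      then show ?case using x0 ls_order_pil[OF U, of \<tau> M D d "Suc t"] by auto
    next
      case (Suc k)
      then show ?case using ls_order_pil[OF U, of \<tau> M D d "t + Suc (Suc k)"] by (auto simp: xS)
    qed
    obtain k where k: "\<tau> = Suc k" using False by (cases \<tau>) auto
    \<comment> \<open>The projection from period \<open>t + 1\<close> averages over a demand window
      starting one period later. Stationarity moves it to the window starting at \<open>t\<close>,
      so that both projections can be compared path by path.\<close>
    have "proj_end_inv M D \<tau> (Suc t) (?x (Suc t)) = (\<integral> \<omega>. end_inv_from (?x (Suc t)) (\<lambda>i. D (t + i) \<omega>) k \<partial>M)"
      using end_inv_from_shift[of "?x (Suc t)" "Suc t"] end_inv_from_shift[of "?x (Suc t)" t]
      by (simp add: proj_end_inv_def k)
    also have "\<dots> \<le> (\<integral> \<omega>. end_inv_from (?x t) (\<lambda>i. D (t + i) \<omega>) k + ?q (t + \<tau>) \<partial>M)"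
      using le[of k] integrable_end_inv_from
      by (intro Bochner_Integration.integral_mono Bochner_Integration.integrable_add) (auto simp: k)
    also have "\<dots> = proj_end_inv M D \<tau> t (?x t) + ?q (t + \<tau>)"
      using integrable_end_inv_from by (simp add: proj_end_inv_def k prob_space)
    finally show ?thesis using order by simp
  qed
qed

section \<open>Costs of a single period\<close>

lemma integrable_newsvendor:
  fixes X :: "'a \<Rightarrow> real"
  assumes "integrable M X"
  shows "integrable M (\<lambda>\<omega>. h * max 0 (X \<omega> - a) + p * max 0 (a - X \<omega>))"
  using assms by (intro Bochner_Integration.integrable_add integrable_mult_right integrable_max) auto

lemma base_stock_cost_eq:
  "base_stock_cost M D \<tau> h p S =
    (\<integral> \<omega>. h * max 0 (S - (\<Sum>i\<le>\<tau>. D (s + i) \<omega>)) + p * max 0 ((\<Sum>i\<le>\<tau>. D (s + i) \<omega>) - S) \<partial>M)"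
proof -
  let ?f = "\<lambda>d. h * max 0 (S - (\<Sum>i\<le>\<tau>. d i)) + p * max 0 ((\<Sum>i\<le>\<tau>. d i) - S) :: real"
  have "(\<integral> \<omega>. ?f (\<lambda>i. D (s + i) \<omega>) \<partial>M) = (\<integral> \<omega>. ?f (\<lambda>i. D i \<omega>) \<partial>M)"
    by (rule integral_shift) measurable
  also have "\<dots> = base_stock_cost M D \<tau> h p S"
    unfolding base_stock_cost_def atLeast0AtMost
    by (subst Bochner_Integration.integral_add)
      (auto intro!: integrable_mult_right integrable_max Bochner_Integration.integrable_diff
        Bochner_Integration.integrable_sum)
  finally show ?thesis by simp
qed

text \<open>The bound holds for every frozen history before period \<open>s\<close>, with the same
  constant, and therefore survives averaging over histories.\<close>

lemma pil_period_cost_le: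
  fixes \<tau> :: nat and U h p :: real
  assumes U: "0 \<le> U" and hp: "0 < h" "0 < p"
  defines "A \<equiv> pil_policy M D \<tau> U"
  shows "(\<integral>\<^sup>+ \<omega>. ennreal (h * ls_end_inv \<tau> A (\<lambda>i. D i \<omega>) (s + \<tau>) + p * ls_lost \<tau> A (\<lambda>i. D i \<omega>) (s + \<tau>)) \<partial>M)
    \<le> ennreal (base_stock_cost M D \<tau> h p (U + real \<tau> * \<mu>))"
proof -
  define f where "f d = ennreal (h * ls_end_inv \<tau> A d (s + \<tau>) + p * ls_lost \<tau> A d (s + \<tau>))" for d
  have [measurable]: "(\<lambda>d. ls_inv \<tau> A d (s + \<tau>)) \<in> borel_measurable (PiM UNIV (\<lambda>_. borel))"
    unfolding A_def by (rule ls_inv_pil_measurable)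
  have f: "f \<in> borel_measurable (PiM UNIV (\<lambda>_. borel))"
    unfolding f_def ls_end_inv_def ls_lost_def by measurable
  have inner: "(\<integral>\<^sup>+ \<omega>'. f (\<lambda>i. if i < s then D i \<omega> else D i \<omega>') \<partial>M)
      \<le> ennreal (base_stock_cost M D \<tau> h p (U + real \<tau> * \<mu>))" if \<omega>: "\<omega> \<in> space M" for \<omega>
  proof -
    define d where "d \<omega>' i = (if i < s then D i \<omega> else D i \<omega>')" for \<omega>' i
    define x where "x = ls_state \<tau> A (\<lambda>i. D i \<omega>) s"
    define J where "J \<omega>' = ls_carry \<tau> A (d \<omega>') (s + \<tau>)" for \<omega>'
    define c where "c = (\<integral> \<omega>. J \<omega> \<partial>M)"
    \<comment> \<open>\<open>X\<close> and \<open>Y\<close> are the centred net inventories after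
      the demand of period \<open>s + \<tau>\<close>, in the lost sales system and under the
      base-stock policy with level \<open>U + \<tau> * \<mu>\<close>. Both uncentred versions have
      mean \<open>U - \<mu>\<close>, which explains the threshold \<open>\<mu> - U\<close>
      below.\<close>
    define X where "X \<omega>' = J \<omega>' - c + (\<mu> - D (s + \<tau>) \<omega>')" for \<omega>'
    define Y where "Y \<omega>' = real (Suc \<tau>) * \<mu> - (\<Sum>i\<le>\<tau>. D (s + i) \<omega>')" for \<omega>'
    have x: "ls_state \<tau> A (d \<omega>') s = x" for \<omega>'
      unfolding x_def by (rule ls_state_cong) (simp add: d_def)
    \<comment> \<open>With zero lead time the state is the carried inventory itself, so
      \<open>J\<close> is constant once the history is frozen.\<close>
    have J0: "J = (\<lambda>\<omega>'. x ! 0)" if "\<tau> = 0"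
    proof
      show "J \<omega>' = x ! 0" for \<omega>'
        using that by (simp add: J_def ls_state.simps flip: x[of \<omega>'])
    qed
    have JS: "J = (\<lambda>\<omega>'. end_inv_from x (\<lambda>i. D (s + i) \<omega>') k)" if "\<tau> = Suc k" for k
    proof
      show "J \<omega>' = end_inv_from x (\<lambda>i. D (s + i) \<omega>') k" for \<omega>'
        using ls_carry_add_Suc[of k \<tau> A "d \<omega>'" s] that x[of \<omega>'] by (simp add: J_def d_def)
    qed
    have Ji: "integrable M J"
      using integrable_end_inv_from by (cases \<tau>) (simp_all add: J0 JS)
    have c: "c = proj_end_inv M D \<tau> s x"
      unfolding c_def proj_end_inv_def by (cases \<tau>) (simp_all add: J0 JS prob_space)
    have cU: "c \<le> U"
      unfolding c x_def A_def using nonneg \<omega> by (intro proj_end_inv_pil_le U) auto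
    have I: "ls_inv \<tau> A (d \<omega>') (s + \<tau>) = J \<omega>' + (U - c)" for \<omega>'
    proof -
      have "A s x = U - c" using cU by (simp add: A_def pil_policy_def c)
      then show ?thesis by (simp add: ls_inv.simps J_def ls_order.simps x)
    qed
    have Xi: "integrable M X" and Yi: "integrable M Y"
      unfolding X_def[abs_def] Y_def[abs_def] using Ji by auto
    have XE: "(\<integral> \<omega>. X \<omega> \<partial>M) = 0" and YE: "(\<integral> \<omega>. Y \<omega> \<partial>M) = 0"
      unfolding X_def Y_def using Ji by (simp_all add: c_def prob_space)
    have XY: "stop_loss_le X Y"
    proof (cases \<tau>)
      case 0
      then have "X = Y" by (auto simp: X_def Y_def c_def J0 prob_space)
      then show ?thesis by (simp add: stop_loss_le_refl)
    next
      case (Suc k)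
      show ?thesis
        using stop_loss_le_minus_demand[OF stop_loss_le_end_inv_from, of x s k]
        by (simp add: X_def[abs_def] Y_def[abs_def] c_def JS[OF Suc] Suc)
    qed
    have "(\<integral>\<^sup>+ \<omega>'. f (d \<omega>') \<partial>M) =
        (\<integral>\<^sup>+ \<omega>'. ennreal (h * max 0 (X \<omega>' - (\<mu> - U)) + p * max 0 ((\<mu> - U) - X \<omega>')) \<partial>M)"
      unfolding f_def ls_end_inv_def ls_lost_def I X_def by (simp add: d_def algebra_simps)
    also have "\<dots> = ennreal (\<integral> \<omega>'. h * max 0 (X \<omega>' - (\<mu> - U)) + p * max 0 ((\<mu> - U) - X \<omega>') \<partial>M)"
      using hp by (intro nn_integral_eq_integral integrable_newsvendor Xi) auto
    also have "\<dots> \<le> ennreal (\<integral> \<omega>'. h * max 0 (Y \<omega>' - (\<mu> - U)) + p * max 0 ((\<mu> - U) - Y \<omega>') \<partial>M)"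
      using hp by (intro ennreal_leI newsvendor_cost_mono XY Xi Yi) (auto simp: XE YE)
    also have "\<dots> = ennreal (base_stock_cost M D \<tau> h p (U + real \<tau> * \<mu>))"
      unfolding base_stock_cost_eq[where s = s] Y_def by (simp add: algebra_simps)
    finally show ?thesis by (simp add: d_def[abs_def])
  qed
  have "(\<integral>\<^sup>+ \<omega>. f (\<lambda>i. D i \<omega>) \<partial>M) = (\<integral>\<^sup>+ \<omega>. \<integral>\<^sup>+ \<omega>'. f (\<lambda>i. if i < s then D i \<omega> else D i \<omega>') \<partial>M \<partial>M)"
    by (rule nn_integral_merge[OF indep f])
  also have "\<dots> \<le> (\<integral>\<^sup>+ \<omega>. ennreal (base_stock_cost M D \<tau> h p (U + real \<tau> * \<mu>)) \<partial>M)"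
    by (rule nn_integral_mono) (rule inner)
  finally show ?thesis by (simp add: f_def emeasure_space_1)
qed

text \<open>At level zero the bounds on orders and carried inventory both collapse to zero, so all
  demand is lost. This serves the case in which the target level is clipped at zero.\<close>

lemma pil_0_period_cost:
  assumes "0 < p"
  shows "(\<integral>\<^sup>+ \<omega>. ennreal (h * ls_end_inv \<tau> (pil_policy M D \<tau> 0) (\<lambda>i. D i \<omega>) t
      + p * ls_lost \<tau> (pil_policy M D \<tau> 0) (\<lambda>i. D i \<omega>) t) \<partial>M) = ennreal (p * \<mu>)"
proof -
  let ?A = "pil_policy M D \<tau> 0"
  have I: "ls_inv \<tau> ?A (\<lambda>i. D i \<omega>) t = 0" if "\<omega> \<in> space M" for \<omega>
    using ls_order_pil[of 0 \<tau> M D "\<lambda>i. D i \<omega>" t] ls_carry_nonneg[of \<tau> ?A "\<lambda>i. D i \<omega>" t]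
      ls_carry_pil_le[of 0 "\<lambda>i. D i \<omega>" \<tau> M D t] nonneg[OF that]
    by (simp add: ls_inv.simps)
  have "(\<integral>\<^sup>+ \<omega>. ennreal (h * ls_end_inv \<tau> ?A (\<lambda>i. D i \<omega>) t + p * ls_lost \<tau> ?A (\<lambda>i. D i \<omega>) t) \<partial>M)
      = (\<integral>\<^sup>+ \<omega>. ennreal (p * D t \<omega>) \<partial>M)"
    by (intro nn_integral_cong) (simp add: ls_end_inv_def ls_lost_def I nonneg)
  also have "\<dots> = ennreal (\<integral> \<omega>. p * D t \<omega> \<partial>M)"
    using assms nonneg by (intro nn_integral_eq_integral integrable_mult_right integrable_D AE_I2) auto
  finally show ?thesis by simp
qed

text \<open>Dropping the holding cost and bounding the positive part of the shortage below by the
  shortage itself leaves a linear expression with known mean.\<close>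

lemma base_stock_cost_ge:
  assumes hp: "0 < h" "0 < p"
  shows "p * (real (Suc \<tau>) * \<mu> - S) \<le> base_stock_cost M D \<tau> h p S"
proof -
  let ?X = "\<lambda>\<omega>. \<Sum>i\<le>\<tau>. D (0 + i) \<omega>"
  have "p * (real (Suc \<tau>) * \<mu> - S) = (\<integral> \<omega>. p * (?X \<omega> - S) \<partial>M)"
    by (simp add: prob_space)
  also have "\<dots> \<le> (\<integral> \<omega>. p * max 0 (?X \<omega> - S) + h * max 0 (S - ?X \<omega>) \<partial>M)"
  proof (rule Bochner_Integration.integral_mono)
    show "integrable M (\<lambda>\<omega>. p * max 0 (?X \<omega> - S) + h * max 0 (S - ?X \<omega>))"
      by (rule integrable_newsvendor) simp
    show "p * (?X \<omega> - S) \<le> p * max 0 (?X \<omega> - S) + h * max 0 (S - ?X \<omega>)" for \<omega>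
      using hp by (intro add_increasing2 mult_left_mono) auto
  qed simp
  also have "\<dots> = base_stock_cost M D \<tau> h p S"
    unfolding base_stock_cost_eq[where s = 0] by (simp add: add.commute)
  finally show ?thesis .
qed

section \<open>From period costs to the cost-rate\<close>

lemma ls_cost_rate_pil_le:
  fixes \<tau> :: nat and h p U :: real
  assumes hp: "0 < h" "0 < p"
  defines "A \<equiv> pil_policy M D \<tau> U"
  assumes K: "\<And>t. \<tau> \<le> t \<Longrightarrow>
      (\<integral>\<^sup>+ \<omega>. ennreal (h * ls_end_inv \<tau> A (\<lambda>i. D i \<omega>) t + p * ls_lost \<tau> A (\<lambda>i. D i \<omega>) t) \<partial>M) \<le> K"
  shows "ls_cost_rate M D \<tau> h p A \<le> K"
  unfolding ls_cost_rate_def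
proof (rule Limsup_bounded[OF eventually_mono[OF eventually_ge_at_top[of \<tau>]]])
  \<comment> \<open>For \<open>T \<ge> \<tau>\<close> the factor is the reciprocal of the number of
    summands, so a uniform bound on the summands bounds the average.\<close>
  fix T assume T: "\<tau> \<le> T"
  let ?c = "\<lambda>t \<omega>. h * ls_end_inv \<tau> A (\<lambda>i. D i \<omega>) t + p * ls_lost \<tau> A (\<lambda>i. D i \<omega>) t"
  let ?n = "real T - real \<tau> + 1"
  have n: "0 < ?n" using T by simp
  have pos: "0 \<le> ?c t \<omega>" for t \<omega> using hp by (simp add: ls_end_inv_def ls_lost_def)
  have "(\<lambda>\<omega> i. D i \<omega>) \<in> measurable M (PiM UNIV (\<lambda>_. borel))"
    by (rule measurable_PiM_single') auto
  from measurable_compose[OF this ls_inv_pil_measurable]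
  have [measurable]: "(\<lambda>\<omega>. ls_inv \<tau> A (\<lambda>i. D i \<omega>) t) \<in> borel_measurable M" for t
    unfolding A_def .
  have [measurable]: "?c t \<in> borel_measurable M" for t
    unfolding ls_end_inv_def ls_lost_def by measurable
  have "(\<integral>\<^sup>+ \<omega>. ennreal ((1 / ?n) * (\<Sum>t = \<tau>..T. ?c t \<omega>)) \<partial>M)
      = (\<integral>\<^sup>+ \<omega>. ennreal (1 / ?n) * (\<Sum>t = \<tau>..T. ennreal (?c t \<omega>)) \<partial>M)"
    using n pos by (intro nn_integral_cong) (simp add: sum_ennreal ennreal_mult'[symmetric])
  also have "\<dots> = ennreal (1 / ?n) * (\<Sum>t = \<tau>..T. \<integral>\<^sup>+ \<omega>. ennreal (?c t \<omega>) \<partial>M)"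
    by (simp add: nn_integral_cmult nn_integral_sum)
  also have "\<dots> \<le> ennreal (1 / ?n) * (\<Sum>t = \<tau>..T. K)"
    using K by (intro mult_left_mono sum_mono) auto
  also have "(\<Sum>t = \<tau>..T. K) = of_nat (card {\<tau>..T}) * K"
    by (rule sum_constant)
  also have "of_nat (card {\<tau>..T}) = ennreal ?n"
    unfolding ennreal_of_nat_eq_real_of_nat
    using T by (intro arg_cong[where f = ennreal]) (simp add: of_nat_diff)
  also have "ennreal (1 / ?n) * (ennreal ?n * K) = ennreal (1 / ?n) * ennreal ?n * K"
    by (simp only: mult.assoc)
  also have "ennreal (1 / ?n) * ennreal ?n = 1"
    using n by (subst ennreal_mult'[symmetric]) simp_all
  finally show "(\<integral>\<^sup>+ \<omega>. ennreal ((1 / ?n) * (\<Sum>t = \<tau>..T. ?c t \<omega>)) \<partial>M) \<le> K" by simp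
qed

end

theorem theorem3:
  fixes M :: "'a measure" and D :: "nat \<Rightarrow> 'a \<Rightarrow> real"
    and \<tau> :: nat and h p \<mu> Sstar Ustar :: real
  assumes "prob_space M"
    and "prob_space.indep_vars M (\<lambda>_. borel) D UNIV"
    and "\<And>t. distr M borel (D t) = distr M borel (D 0)"
    and "\<And>t \<omega>. \<omega> \<in> space M \<Longrightarrow> 0 \<le> D t \<omega>"
    and "integrable M (D 0)"
    and "h > 0" and "p > 0"
    and "\<mu> = (\<integral> \<omega>. D 0 \<omega> \<partial>M)"
    and "Sstar = base_stock_level M D \<tau> h p"
  shows "(is_arg_min (\<lambda>U. ls_cost_rate M D \<tau> h p (pil_policy M D \<tau> U)) (\<lambda>U. U \<ge> 0) Ustar \<longrightarrow>
            ls_cost_rate M D \<tau> h p (pil_policy M D \<tau> Ustar)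
              \<le> ls_cost_rate M D \<tau> h p (pil_policy M D \<tau> (max 0 (Sstar - real \<tau> * \<mu>))))
       \<and> ls_cost_rate M D \<tau> h p (pil_policy M D \<tau> (max 0 (Sstar - real \<tau> * \<mu>)))
            \<le> ennreal (base_stock_cost M D \<tau> h p Sstar)"
proof -
  interpret iid_demand M D \<mu>
    using assms by (intro iid_demand.intro iid_demand_axioms.intro)
  let ?U = "max 0 (Sstar - real \<tau> * \<mu>)"
  let ?K = "ennreal (base_stock_cost M D \<tau> h p Sstar)"
  have "ls_cost_rate M D \<tau> h p (pil_policy M D \<tau> ?U) \<le> ?K"
  proof (rule ls_cost_rate_pil_le[OF \<open>h > 0\<close> \<open>p > 0\<close>])
    fix t assume "\<tau> \<le> t"
    show "(\<integral>\<^sup>+ \<omega>. ennreal (h * ls_end_inv \<tau> (pil_policy M D \<tau> ?U) (\<lambda>i. D i \<omega>) t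
        + p * ls_lost \<tau> (pil_policy M D \<tau> ?U) (\<lambda>i. D i \<omega>) t) \<partial>M) \<le> ?K"
    \<comment> \<open>If the level is not clipped, then \<open>?U + \<tau> * \<mu>\<close> is
      exactly \<open>Sstar\<close>; otherwise the policy never orders.\<close>
    proof (cases "real \<tau> * \<mu> \<le> Sstar")
      case True
      then show ?thesis
        using pil_period_cost_le[of ?U h p \<tau> "t - \<tau>"] \<open>\<tau> \<le> t\<close> \<open>h > 0\<close> \<open>p > 0\<close>
        by (simp add: max_def)
    next
      case False
      then have U0: "?U = 0" by simp
      have "p * \<mu> \<le> p * (real (Suc \<tau>) * \<mu> - Sstar)"
        using False \<open>p > 0\<close> by (intro mult_left_mono) (auto simp: algebra_simps)
      also have "\<dots> \<le> base_stock_cost M D \<tau> h p Sstar"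
        by (rule base_stock_cost_ge[OF \<open>h > 0\<close> \<open>p > 0\<close>])
      finally show ?thesis
        unfolding U0 pil_0_period_cost[OF \<open>p > 0\<close>] by (rule ennreal_leI)
    qed
  qed
  \<comment> \<open>The comparison with \<open>Ustar\<close> is minimality applied to the feasible
    level \<open>?U\<close>.\<close>
  then show ?thesis
    by (auto simp: is_arg_min_linorder)
qed

end
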